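(* Consider the line arrangement in $\mathbb{P}^2=\mathbb{P}^2_{\mathbb{C}}$ $$\mathcal{A}^2_m: xy(x^m-y^m)(y^m-z^m)(z^m-x^m)=0.$$ The line arrangement $\mathcal{A}^2_m$ in $\mathbb{P}^2$ is supersolvable and has a unique modular point, namely $p=(0:0:1)$. In particular, $\mathcal{A}^2_m$ is free with exponents $(m+1,2m)$, and the corresponding dual set of points $Z$ admits unexpected curves of degree $j$ for $m\geq 3$ and any integer $j$ satisfying $$m+2\leq j\leq 2m-1.$$ The unexpected curves of minimal degree $j=m+2$ are all irreducible.
   Context: Work over $\mathbb{C}$, $S=\mathbb{C}[x,y,z]$; $m$ is a positive integer. For an arrangement $\mathcal{A}:f=0$ of $d$ distinct lines in $\mathbb{P}^2$, $AR(f)$ is the graded $S$-module of triples $(a,b,c)\in S^3$ with $af_x+bf_y+cf_z=0$. $\mathcal{A}$ is free with exponents $(d_1,d_2)$ if $AR(f)$ is a free graded $S$-module (of rank 2) with homogeneous generators of degrees $d_1,d_2$; then $d_1+d_2=d-1$. An intersection point $p$ of $\mathcal{A}$ is modular if for every other intersection point $p'$ of $\mathcal{A}$ the line $\overline{pp'}$ belongs to $\mathcal{A}$; $\mathcal{A}$ is supersolvable if it has a modular point. Unexpected curves: a finite set $Z\subset\mathbb{P}^2$ admits unexpected curves of degree $j\geq 2$ if, for a generic point $q\in\mathbb{P}^2$, $$h^0(\mathbb{P}^2,\mathcal{O}_{\mathbb{P}^2}(j)\otimes\mathcal{I}(Z+(j-1)q))>\max\left(0,\ h^0(\mathbb{P}^2,\mathcal{O}_{\mathbb{P}^2}(j)\otimes\mathcal{I}(Z))-\binom{j}{2}\right),$$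 where $\mathcal{I}(Z)$ is the ideal sheaf of functions vanishing on $Z$ and $\mathcal{I}(Z+(j-1)q)$ is the ideal sheaf of functions vanishing on $Z$ and vanishing to order $j-1$ at $q$. An unexpected curve of degree $j$ (for generic $q$) is then a curve $C_q$ of degree $j$ passing through all points of $Z$ and having multiplicity at least $j-1$ at $q$. Duality: a point $(a:b:c)\in\mathbb{P}^2$ is dual to the line $ax+by+cz=0$; the set dual to a line arrangement is the set of points dual to its lines.
   Formalization: Uniqueness of the modular point (0:0:1) is stated only for m ≥ 2, since for m = 1 the point (1:1:1) is also modular; all other claims are as stated. *)

theory Defs
  imports
    "HOL-Analysis.Analysis"
    "HOL-Computational_Algebra.Computational_Algebra"
begin

section \<open>The polynomial ring in three variables\<close>

text \<open>
  \<open>\<complex>[x,y,z]\<close> is the iterated polynomial ring \<open>\<complex>[x][y][z]\<close>: the innermost variable is \<open>x\<close>,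
  the outermost one is \<open>z\<close>.
\<close>

type_synonym poly3 = "complex poly poly poly"

definition varX :: poly3 where "varX = [:[:[:0, 1:]:]:]"
definition varY :: poly3 where "varY = [:[:0, 1:]:]"
definition varZ :: poly3 where "varZ = [:0, 1:]"

definition eval3 :: "poly3 \<Rightarrow> complex^3 \<Rightarrow> complex" where
  "eval3 F v = poly (poly (poly F [:[:v $ 3:]:]) [:v $ 2:]) (v $ 1)"

definition derivX :: "poly3 \<Rightarrow> poly3" where "derivX = map_poly (map_poly pderiv)"
definition derivY :: "poly3 \<Rightarrow> poly3" where "derivY = map_poly pderiv"
definition derivZ :: "poly3 \<Rightarrow> poly3" where "derivZ = pderiv"

text \<open>As usual, the zero polynomial is homogeneous of every degree.\<close>

definition homogeneous :: "nat \<Rightarrow> poly3 \<Rightarrow> bool" where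
  "homogeneous d F \<longleftrightarrow>
     (\<forall>i j k. coeff (coeff (coeff F k) j) i \<noteq> 0 \<longrightarrow> i + j + k = d)"

definition smultC :: "complex \<Rightarrow> poly3 \<Rightarrow> poly3" where
  "smultC c F = smult [:[:c:]:] F"

lemma vector_space_smultC: "vector_space smultC"
  by unfold_locales
    (simp_all add: smultC_def smult_add_right smult_add_left [symmetric] one_pCons [symmetric])


section \<open>The complex projective plane\<close>

definition proportional :: "complex^3 \<Rightarrow> complex^3 \<Rightarrow> bool" where
  "proportional u v \<longleftrightarrow> u \<noteq> 0 \<and> v \<noteq> 0 \<and> (\<exists>c. v = c *s u)"

lemma part_equivp_proportional: "part_equivp proportional"
proof (rule part_equivpI)
  show "\<exists>u. proportional u u"
    by (rule exI [of _ 1]) (auto simp: proportional_def intro: exI [of _ 1])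
  show "symp proportional"
  proof (rule sympI)
    fix u v assume "proportional u v"
    then obtain c where c: "u \<noteq> 0" "v \<noteq> 0" "v = c *s u"
      by (auto simp: proportional_def)
    then have "u = inverse c *s v"
      by (cases "c = 0") auto
    with c show "proportional v u"
      unfolding proportional_def by blast
  qed
  show "transp proportional"
    by (rule transpI) (auto simp: proportional_def)
qed

quotient_type proj_plane = "complex^3" / partial: proportional
  by (rule part_equivp_proportional)

definition pt :: "complex \<Rightarrow> complex \<Rightarrow> complex \<Rightarrow> proj_plane" where
  "pt a b c = abs_proj_plane (vector [a, b, c])"

definition hcoords :: "proj_plane \<Rightarrow> (complex^3) set" where
  "hcoords p = {v. v \<noteq> 0 \<and> abs_proj_plane v = p}"

definition vanishes_at :: "poly3 \<Rightarrow> proj_plane \<Rightarrow> bool" where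
  "vanishes_at F p \<longleftrightarrow> (\<forall>v\<in>hcoords p. eval3 F v = 0)"

text \<open>
  For a homogeneous \<open>F\<close>, vanishing to order at least \<open>n\<close> at \<open>p\<close> means that all partial
  derivatives of \<open>F\<close> of order less than \<open>n\<close> vanish at \<open>p\<close>.
\<close>

definition vanishes_to_order :: "nat \<Rightarrow> poly3 \<Rightarrow> proj_plane \<Rightarrow> bool" where
  "vanishes_to_order n F p \<longleftrightarrow>
     (\<forall>i j k. i + j + k < n \<longrightarrow>
        vanishes_at ((derivX ^^ i) ((derivY ^^ j) ((derivZ ^^ k) F))) p)"

definition zariski_closed :: "proj_plane set \<Rightarrow> bool" where
  "zariski_closed C \<longleftrightarrow>
     (\<exists>T. (\<forall>F\<in>T. \<exists>d. homogeneous d F) \<and> C = {q. \<forall>F\<in>T. vanishes_at F q})"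

text \<open>A property holds for a generic point if it holds on a nonempty Zariski open set.\<close>

definition generic :: "(proj_plane \<Rightarrow> bool) \<Rightarrow> bool" where
  "generic P \<longleftrightarrow> (\<exists>U. zariski_closed (- U) \<and> U \<noteq> {} \<and> (\<forall>q\<in>U. P q))"


section \<open>Line arrangements\<close>

definition dual_line :: "proj_plane \<Rightarrow> proj_plane set" where
  "dual_line p =
     {q. \<forall>u\<in>hcoords p. \<forall>v\<in>hcoords q. u $ 1 * v $ 1 + u $ 2 * v $ 2 + u $ 3 * v $ 3 = 0}"

text \<open>
  A line arrangement is a set of lines. The arrangement \<open>f = 0\<close>, for a product \<open>f\<close> of linear
  forms, consists of the lines contained in the zero locus of \<open>f\<close>.
\<close>

definition arrangement :: "poly3 \<Rightarrow> proj_plane set set" where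
  "arrangement f = {L. (\<exists>p. L = dual_line p) \<and> (\<forall>q\<in>L. vanishes_at f q)}"

definition dual_points :: "proj_plane set set \<Rightarrow> proj_plane set" where
  "dual_points A = {p. dual_line p \<in> A}"

definition intersection_points :: "proj_plane set set \<Rightarrow> proj_plane set" where
  "intersection_points A = {q. \<exists>L\<in>A. \<exists>M\<in>A. L \<noteq> M \<and> q \<in> L \<and> q \<in> M}"

definition modular_point :: "proj_plane set set \<Rightarrow> proj_plane \<Rightarrow> bool" where
  "modular_point A p \<longleftrightarrow>
     p \<in> intersection_points A \<and>
     (\<forall>p'\<in>intersection_points A. p' \<noteq> p \<longrightarrow> (\<exists>L\<in>A. p \<in> L \<and> p' \<in> L))"

definition supersolvable :: "proj_plane set set \<Rightarrow> bool" where
  "supersolvable A \<longleftrightarrow> (\<exists>p. modular_point A p)"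


section \<open>Free arrangements\<close>

lemma module_poly3_vec: "module ((*s) :: poly3 \<Rightarrow> poly3^3 \<Rightarrow> poly3^3)"
  by unfold_locales (simp_all add: vec_eq_iff algebra_simps)

definition AR :: "poly3 \<Rightarrow> (poly3^3) set" where
  "AR f = {r. r $ 1 * derivX f + r $ 2 * derivY f + r $ 3 * derivZ f = 0}"

definition free_with_exponents :: "poly3 \<Rightarrow> nat \<Rightarrow> nat \<Rightarrow> bool" where
  "free_with_exponents f d1 d2 \<longleftrightarrow>
     (\<exists>r s :: poly3^3. r \<noteq> s \<and>
        (\<forall>i. homogeneous d1 (r $ i)) \<and> (\<forall>i. homogeneous d2 (s $ i)) \<and>
        \<not> module.dependent (*s) {r, s} \<and>
        module.span (*s) {r, s} = AR f)"


section \<open>Unexpected curves\<close>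

text \<open>
  The global sections of \<open>\<O>(j)\<close> are the forms of degree \<open>j\<close>, so \<open>H\<^sup>0(\<O>(j) \<otimes> \<I>(Z))\<close> is the space
  of degree \<open>j\<close> forms vanishing on \<open>Z\<close>, and \<open>H\<^sup>0(\<O>(j) \<otimes> \<I>(Z + n q))\<close> is its subspace of
  forms vanishing to order at least \<open>n\<close> at \<open>q\<close>.
\<close>

definition forms_through :: "nat \<Rightarrow> proj_plane set \<Rightarrow> poly3 set" where
  "forms_through j Z = {F. homogeneous j F \<and> (\<forall>p\<in>Z. vanishes_at F p)}"

definition forms_through_mult ::
    "nat \<Rightarrow> proj_plane set \<Rightarrow> nat \<Rightarrow> proj_plane \<Rightarrow> poly3 set" where
  "forms_through_mult j Z n q = {F \<in> forms_through j Z. vanishes_to_order n F q}"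

definition dimC :: "poly3 set \<Rightarrow> nat" where
  "dimC V = vector_space.dim smultC V"

definition admits_unexpected_curves :: "proj_plane set \<Rightarrow> nat \<Rightarrow> bool" where
  "admits_unexpected_curves Z j \<longleftrightarrow>
     finite Z \<and> 2 \<le> j \<and>
     generic (\<lambda>q. int (dimC (forms_through_mult j Z (j - 1) q))
                  > max 0 (int (dimC (forms_through j Z)) - int (j choose 2)))"

text \<open>The equation of a curve of degree \<open>j\<close> through \<open>Z\<close> of multiplicity at least \<open>j - 1\<close> at \<open>q\<close>.\<close>

definition unexpected_curve :: "proj_plane set \<Rightarrow> nat \<Rightarrow> proj_plane \<Rightarrow> poly3 \<Rightarrow> bool" where
  "unexpected_curve Z j q F \<longleftrightarrow> F \<noteq> 0 \<and> F \<in> forms_through_mult j Z (j - 1) q"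


section \<open>The arrangements under consideration\<close>

definition fA2 :: "nat \<Rightarrow> poly3" where
  "fA2 m = varX * varY * (varX ^ m - varY ^ m) * (varY ^ m - varZ ^ m) * (varZ ^ m - varX ^ m)"

end

theory Submission
  imports Defs "HOL-Computational_Algebra.Field_as_Ring"
begin

unbundle no fps_syntax

text \<open>
  Freeness: a derivation preserving all the lines is a combination of the Euler derivation,
  \<open>\<theta> = (x\<^sup>m\<^sup>+\<^sup>1, y\<^sup>m\<^sup>+\<^sup>1, z\<^sup>m\<^sup>+\<^sup>1)\<close> and \<open>(0, 0, (y\<^sup>m - z\<^sup>m)(z\<^sup>m - x\<^sup>m))\<close>; subtracting multiples
  of the Euler derivation from the last two gives a basis of the syzygies.

  Unexpected curves: for a generic point \<open>q\<close> the equation \<open>u \<bullet> \<theta>(u \<times> q) = 0\<close> in \<open>u\<close> defines a curve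
  of degree \<open>m + 2\<close> through the \<open>3m + 2\<close> dual points with multiplicity \<open>m + 1\<close> at \<open>q\<close>. Projecting
  from \<open>q\<close>, a form of degree \<open>d\<close> and multiplicity \<open>d - 1\<close> becomes linear in one variable, so
  it is irreducible if its two coefficients are coprime, and two such forms are compared by a
  binary form of small degree which vanishes on the projections of the dual points. This gives
  irreducibility and uniqueness in degree \<open>m + 2\<close>, and nonexistence in lower degree. In higher
  degree one multiplies by lines through \<open>q\<close>; the dual points impose independent conditions, so
  these curves are more than expected.
\<close>

section \<open>Forms in three variables as polynomial functions\<close>

text \<open>The equation u . theta(u x q) = 0 is explained by duality. If u is dual to a line of the
  arrangement, this line consists of the v orthogonal to u, and theta maps it into itself; u x q
  lies on it, so the equation holds at u. The coordinates of u x q are linear forms in u vanishing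
  at q, and their powers with exponent m + 1 give the multiplicity at q. Two counts fix the ranges
  of m and j. Two forms of degree m + 2 are compared by a binary form of degree at most 2m + 3 with
  3m + 1 known zeros, which is a contradiction from m = 3 on unless it vanishes identically. Lines
  through q yield j - m - 1 independent curves of degree j, whereas the expected number is at most
  max(0, 2j - 3m - 1); the former is larger exactly for m + 2 <= j <= 2m - 1.\<close>

definition ev :: "poly3 \<Rightarrow> complex \<Rightarrow> complex \<Rightarrow> complex \<Rightarrow> complex" where
  "ev F x y z = poly (poly (poly F [:[:z:]:]) [:y:]) x"

lemma eval3_vector: "eval3 F (vector [x, y, z]) = ev F x y z"
  by (simp add: eval3_def ev_def)

lemma eval3_eq_ev: "eval3 F v = ev F (v $ 1) (v $ 2) (v $ 3)"
  by (simp add: eval3_def ev_def)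

lemma ev_simps [simp]:
  "ev 0 x y z = 0" "ev 1 x y z = 1"
  "ev (F + G) x y z = ev F x y z + ev G x y z"
  "ev (F - G) x y z = ev F x y z - ev G x y z"
  "ev (- F) x y z = - ev F x y z"
  "ev (F * G) x y z = ev F x y z * ev G x y z"
  "ev (F ^ n) x y z = ev F x y z ^ n"
  "ev varX x y z = x" "ev varY x y z = y" "ev varZ x y z = z"
  "ev (smultC c F) x y z = c * ev F x y z"
  "ev [:[:[:c:]:]:] x y z = c"
  by (simp_all add: ev_def varX_def varY_def varZ_def smultC_def)

lemma ev_of_nat [simp]: "ev (of_nat n) x y z = of_nat n"
  by (simp add: ev_def)

lemma ev_numeral [simp]: "ev (numeral n) x y z = numeral n"
  by (metis ev_of_nat of_nat_numeral)

lemma ev_sum [simp]: "ev (sum f A) x y z = (\<Sum>i\<in>A. ev (f i) x y z)"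
  by (induction A rule: infinite_finite_induct) auto

lemma ev_prod [simp]: "ev (prod f A) x y z = (\<Prod>i\<in>A. ev (f i) x y z)"
  by (induction A rule: infinite_finite_induct) auto

section \<open>Polynomial identities from values\<close>

lemma poly_eq_0_of_infinite:
  fixes p :: "'a::idom poly"
  assumes "infinite S" "\<And>x. x \<in> S \<Longrightarrow> poly p x = 0"
  shows "p = 0"
proof (rule ccontr)
  assume "p \<noteq> 0"
  from poly_roots_finite [OF this] assms show False
    by (meson finite_subset mem_Collect_eq subsetI)
qed

lemma infinite_range_const: "infinite (range (\<lambda>c::'a. [:c:]))" if "infinite (UNIV :: 'a::zero set)"
proof -
  have "inj (\<lambda>c::'a. [:c:])" by (rule injI) simp
  with that show ?thesis using finite_imageD by blast
qed

lemma infinite_UNIV_complex: "infinite (UNIV :: complex set)"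
  by (rule infinite_UNIV_char_0)

lemma poly2_eqI:
  fixes A B :: "complex poly poly"
  assumes "\<And>x y. poly (poly A [:y:]) x = poly (poly B [:y:]) x"
  shows "A = B"
proof -
  have "poly (A - B) [:y:] = 0" for y
    by (rule poly_eq_0_of_infinite [OF infinite_UNIV_complex]) (simp add: assms)
  then have "A - B = 0"
    by (intro poly_eq_0_of_infinite [OF infinite_range_const [OF infinite_UNIV_complex]]) auto
  then show ?thesis by simp
qed

text \<open>One variable at a time can be specialised, because the constants form an infinite subset
  of each coefficient ring. Most later identities between nested polynomials are proved through
  values by this rule.\<close>

lemma poly3_eqI:
  assumes "\<And>x y z. ev F x y z = ev G x y z"
  shows "F = G"
proof -
  have "poly (F - G) [:[:z:]:] = 0" for z
    by (rule poly2_eqI) (use assms in \<open>simp add: ev_def\<close>)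
  moreover have "infinite (range (\<lambda>c::complex. [:[:c:]:]))"
    using infinite_UNIV_complex finite_imageD [of "\<lambda>c::complex. [:[:c:]:]" UNIV]
    by (auto simp: inj_def)
  ultimately have "F - G = 0"
    by (intro poly_eq_0_of_infinite [of "range (\<lambda>c::complex. [:[:c:]:])"]) auto
  then show ?thesis by simp
qed

lemma poly3_nonzero_point:
  assumes "F \<noteq> 0" obtains x y z where "ev F x y z \<noteq> 0"
  using assms poly3_eqI [of F 0] by auto

section \<open>Formal partial derivatives as analytic ones\<close>

lemma DERIV_poly2_outer:
  "((\<lambda>y. poly (poly g [:y:]) x) has_field_derivative poly (poly (pderiv g) [:y:]) x) (at y)"
  for g :: "complex poly poly"
proof (induction g)
  case (pCons c g)
  from pCons(2) show ?case
    by (auto simp: pderiv_pCons intro!: derivative_eq_intros)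
qed simp

lemma poly_map_poly_pderiv: "poly (map_poly pderiv g) [:y:] = pderiv (poly g [:y:])"
  for g :: "complex poly poly"
  by (induction g) (simp_all add: map_poly_pCons pderiv_add pderiv_smult)

lemma poly_map_poly_const:
  assumes "f 0 = 0" "\<And>p q. f (p + q) = f p + f q" "\<And>p. f (c * p) = c * f p"
  shows "poly (map_poly f F) c = f (poly F c)"
  by (induction F) (simp_all add: map_poly_pCons assms)

lemma DERIV_ev_X: "((\<lambda>x. ev F x y z) has_field_derivative ev (derivX F) x y z) (at x)"
proof -
  have "poly (derivX F) [:[:z:]:] = map_poly pderiv (poly F [:[:z:]:])"
    unfolding derivX_def
    by (rule poly_map_poly_const) (auto intro!: poly_eqI simp: coeff_map_poly pderiv_add pderiv_smult)
  then show ?thesis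
    by (simp add: ev_def poly_map_poly_pderiv poly_DERIV)
qed

lemma DERIV_ev_Y: "((\<lambda>y. ev F x y z) has_field_derivative ev (derivY F) x y z) (at y)"
proof -
  have "poly (derivY F) [:[:z:]:] = pderiv (poly F [:[:z:]:])"
    unfolding derivY_def
    by (rule poly_map_poly_const) (auto simp: pderiv_add pderiv_smult)
  then show ?thesis
    by (simp add: ev_def DERIV_poly2_outer)
qed

lemma DERIV_ev_Z: "((\<lambda>z. ev F x y z) has_field_derivative ev (derivZ F) x y z) (at z)"
  unfolding ev_def derivZ_def
proof (induction F)
  case (pCons c g)
  from pCons(2) show ?case
    by (auto simp: pderiv_pCons intro!: derivative_eq_intros)
qed simp

text \<open>Analytic derivatives are unique and values determine a polynomial, so the rules for
  sums, products and powers below are inherited from the analytic calculus instead of being proved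
  on nested coefficients.\<close>

lemma derivX_eqI: "(\<And>x y z. ((\<lambda>x. ev F x y z) has_field_derivative ev G x y z) (at x)) \<Longrightarrow> derivX F = G"
  by (rule poly3_eqI) (use DERIV_unique DERIV_ev_X in blast)

lemma derivY_eqI: "(\<And>x y z. ((\<lambda>y. ev F x y z) has_field_derivative ev G x y z) (at y)) \<Longrightarrow> derivY F = G"
  by (rule poly3_eqI) (use DERIV_unique DERIV_ev_Y in blast)

lemma derivZ_eqI: "(\<And>x y z. ((\<lambda>z. ev F x y z) has_field_derivative ev G x y z) (at z)) \<Longrightarrow> derivZ F = G"
  by (rule poly3_eqI) (use DERIV_unique DERIV_ev_Z in blast)

lemmas DERIV_ev = DERIV_ev_X DERIV_ev_Y DERIV_ev_Z

lemma deriv3_add [simp]: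
  "derivX (F + G) = derivX F + derivX G"
  "derivY (F + G) = derivY F + derivY G"
  "derivZ (F + G) = derivZ F + derivZ G"
  by (rule derivX_eqI derivY_eqI derivZ_eqI; auto intro!: derivative_eq_intros DERIV_ev)+

lemma deriv3_diff [simp]:
  "derivX (F - G) = derivX F - derivX G"
  "derivY (F - G) = derivY F - derivY G"
  "derivZ (F - G) = derivZ F - derivZ G"
  by (rule derivX_eqI derivY_eqI derivZ_eqI; auto intro!: derivative_eq_intros DERIV_ev)+

lemma deriv3_mult [simp]:
  "derivX (F * G) = derivX F * G + F * derivX G"
  "derivY (F * G) = derivY F * G + F * derivY G"
  "derivZ (F * G) = derivZ F * G + F * derivZ G"
  by (rule derivX_eqI derivY_eqI derivZ_eqI; auto intro!: derivative_eq_intros DERIV_ev)+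

lemma deriv3_power [simp]:
  "derivX (F ^ n) = of_nat n * F ^ (n - 1) * derivX F"
  "derivY (F ^ n) = of_nat n * F ^ (n - 1) * derivY F"
  "derivZ (F ^ n) = of_nat n * F ^ (n - 1) * derivZ F"
  by (rule derivX_eqI derivY_eqI derivZ_eqI; auto intro!: derivative_eq_intros DERIV_ev)+

lemma deriv3_var [simp]:
  "derivX varX = 1" "derivX varY = 0" "derivX varZ = 0"
  "derivY varX = 0" "derivY varY = 1" "derivY varZ = 0"
  "derivZ varX = 0" "derivZ varY = 0" "derivZ varZ = 1"
  by (rule derivX_eqI derivY_eqI derivZ_eqI; auto intro!: derivative_eq_intros)+

section \<open>Monomial expansions and homogeneous forms\<close>

definition monomial3 :: "nat \<Rightarrow> nat \<Rightarrow> nat \<Rightarrow> poly3" where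
  "monomial3 i j k = monom (monom (monom 1 i) j) k"

lemma monomial3_eq: "monomial3 i j k = varX ^ i * varY ^ j * varZ ^ k"
  by (rule poly3_eqI) (simp add: monomial3_def ev_def poly_monom varX_def varY_def varZ_def)

lemma poly3_sum_mono:
  assumes "finite T" "\<And>i j k. coeff (coeff (coeff F k) j) i \<noteq> 0 \<Longrightarrow> (i, j, k) \<in> T"
  shows "F = (\<Sum>(i, j, k)\<in>T. smultC (coeff (coeff (coeff F k) j) i) (monomial3 i j k))"
proof -
  have *: "coeff (coeff (coeff (\<Sum>(i, j, k)\<in>T. smultC (coeff (coeff (coeff F k) j) i) (monomial3 i j k)) k') j') i'
      = coeff (coeff (coeff F k') j') i'" (is "?L = ?R") for i' j' k'
  proof -
    have "?L = (\<Sum>t\<in>T. if t = (i', j', k') then ?R else 0)"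
      unfolding coeff_sum
      by (rule sum.cong) (auto simp: smultC_def monomial3_def split: if_splits)
    also have "\<dots> = ?R"
      using assms by (auto simp: sum.delta)
    finally show ?thesis .
  qed
  show ?thesis
    by (intro poly_eqI) (simp only: *)
qed

lemma finite_support3: "finite {(i, j, k). coeff (coeff (coeff F k) j) i \<noteq> (0::complex)}"
proof -
  have "{(i, j, k). coeff (coeff (coeff F k) j) i \<noteq> (0::complex)} \<subseteq>
    (\<Union>k\<in>{..degree F}. \<Union>j\<in>{..degree (coeff F k)}. \<Union>i\<in>{..degree (coeff (coeff F k) j)}. {(i, j, k)})"
    by (auto simp: le_degree; metis coeff_0 le_degree)
  then show ?thesis by (rule finite_subset) auto
qed

text \<open>Every polynomial is a finite sum of scaled monomials. The rule serves to construct the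
  polynomials behind a substitution (\<open>ev_line\<close>, \<open>ev_shift\<close>) without
  handling coefficients.\<close>

lemma poly3_induct [case_names const var add mult]:
  assumes "\<And>c. P [:[:[:c:]:]:]" "P varX" "P varY" "P varZ"
    and add: "\<And>F G. P F \<Longrightarrow> P G \<Longrightarrow> P (F + G)"
    and mult: "\<And>F G. P F \<Longrightarrow> P G \<Longrightarrow> P (F * G)"
  shows "P F"
proof -
  have 0: "P 0" and 1: "P 1" using assms(1) [of 0] assms(1) [of 1] by (simp_all add: one_pCons)
  have pow: "P (G ^ n)" if "P G" for G n
    by (induction n) (auto simp: 1 that mult)
  have sum: "P (sum g A)" if "\<And>t. t \<in> A \<Longrightarrow> P (g t)" "finite A" for g and A :: "(nat \<times> nat \<times> nat) set"
    using that(2,1) by (induction A rule: finite_induct) (auto simp: 0 add)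
  have smultC: "P (smultC c (monomial3 i j k))" for c i j k
  proof -
    have "P ([:[:[:c:]:]:] * monomial3 i j k)"
      unfolding monomial3_eq by (intro mult pow assms)
    then show ?thesis by (simp add: smultC_def)
  qed
  show ?thesis
    by (subst poly3_sum_mono [OF finite_support3, of F])
       (auto intro!: sum finite_support3 smultC)
qed

lemma ev_line:
  obtains p where "\<And>t. poly p t = ev F (x + t * u) (y + t * v) (z + t * w)"
proof -
  have "\<exists>p. \<forall>t. poly p t = ev F (x + t * u) (y + t * v) (z + t * w)"
  proof (rule poly3_induct [of _ F], goal_cases const X Y Z add mult)
    case (const c) show ?case by (rule exI [of _ "[:c:]"]) simp
  next
    case add then show ?case by (metis ev_simps(3) poly_add)
  next
    case mult then show ?case by (metis ev_simps(6) poly_mult)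
  qed (rule exI [of _ "[:x, u:]"] exI [of _ "[:y, v:]"] exI [of _ "[:z, w:]"], simp)+
  with that show ?thesis by blast
qed

lemma homogeneous_0 [simp]: "homogeneous d 0"
  by (simp add: homogeneous_def)

text \<open>Homogeneity fixes the exponent of z, so pairs (i, j) in a triangle index the monomials;
  the same triangle is counted in \<open>card_triangle\<close>.\<close>

lemma homogeneous_sum_mono:
  assumes "homogeneous d F"
  shows "F = (\<Sum>(i, j)\<in>(SIGMA i:{..d}. {..d - i}).
    smultC (coeff (coeff (coeff F (d - i - j)) j) i) (monomial3 i j (d - i - j)))"
proof -
  let ?S = "SIGMA i:{..d}. {..d - i}" and ?h = "\<lambda>(i, j). (i, j, d - i - j)"
  have "F = (\<Sum>(i, j, k)\<in>?h ` ?S. smultC (coeff (coeff (coeff F k) j) i) (monomial3 i j k))"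
  proof (rule poly3_sum_mono)
    fix i j k assume "coeff (coeff (coeff F k) j) i \<noteq> 0"
    with assms have "i + j + k = d" by (simp add: homogeneous_def)
    then show "(i, j, k) \<in> ?h ` ?S"
      by (intro image_eqI [of _ _ "(i, j)"]) auto
  qed simp
  also have "\<dots> = (\<Sum>(i, j)\<in>?S. smultC (coeff (coeff (coeff F (d - i - j)) j) i) (monomial3 i j (d - i - j)))"
    by (subst sum.reindex) (auto simp: inj_on_def intro!: sum.cong)
  finally show ?thesis .
qed

lemma ev_homogeneous:
  assumes "homogeneous d F"
  shows "ev F (t * x) (t * y) (t * z) = t ^ d * ev F x y z"
proof -
  let ?S = "SIGMA i:{..d}. {..d - i}"
  let ?c = "\<lambda>i j. coeff (coeff (coeff F (d - i - j)) j) i"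
  have *: "ev F x y z = (\<Sum>(i, j)\<in>?S. ?c i j * (x ^ i * y ^ j * z ^ (d - i - j)))" for x y z
    by (subst homogeneous_sum_mono [OF assms]) (simp add: case_prod_beta monomial3_eq)
  have "?c i j * ((t * x) ^ i * (t * y) ^ j * (t * z) ^ (d - i - j))
      = t ^ d * (?c i j * (x ^ i * y ^ j * z ^ (d - i - j)))" if "i \<le> d" "j \<le> d - i" for i j
  proof -
    have "t ^ d = t ^ i * t ^ j * t ^ (d - i - j)"
      using that by (simp flip: power_add)
    then show ?thesis by (simp add: power_mult_distrib)
  qed
  then show ?thesis
    unfolding * sum_distrib_left by (intro sum.cong) auto
qed

lemma homogeneous_add: "homogeneous d F \<Longrightarrow> homogeneous d G \<Longrightarrow> homogeneous d (F + G)"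
  unfolding homogeneous_def by simp (metis add.right_neutral add_0)

lemma homogeneous_smultC: "homogeneous d F \<Longrightarrow> homogeneous d (smultC c F)"
  unfolding homogeneous_def smultC_def by simp

lemma homogeneous_uminus: "homogeneous d F \<Longrightarrow> homogeneous d (- F)"
  unfolding homogeneous_def by simp

lemma homogeneous_diff: "homogeneous d F \<Longrightarrow> homogeneous d G \<Longrightarrow> homogeneous d (F - G)"
  using homogeneous_add [of d F "- G"] homogeneous_uminus by simp

lemma homogeneous_sum: "(\<And>i. i \<in> A \<Longrightarrow> homogeneous d (f i)) \<Longrightarrow> homogeneous d (sum f A)"
  by (induction A rule: infinite_finite_induct) (auto simp: homogeneous_add)

lemma homogeneous_mult:
  assumes "homogeneous d F" "homogeneous e G" shows "homogeneous (d + e) (F * G)"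
  unfolding homogeneous_def
proof (intro allI impI)
  fix i j k
  assume "coeff (coeff (coeff (F * G) k) j) i \<noteq> 0"
  then have "(\<Sum>k'\<le>k. \<Sum>j'\<le>j. \<Sum>i'\<le>i. coeff (coeff (coeff F k') j') i' * coeff (coeff (coeff G (k - k')) (j - j')) (i - i')) \<noteq> 0"
    by (simp add: coeff_mult coeff_sum)
  then obtain k' j' i' where "k' \<le> k" "j' \<le> j" "i' \<le> i"
    "coeff (coeff (coeff F k') j') i' * coeff (coeff (coeff G (k - k')) (j - j')) (i - i') \<noteq> 0"
    by (meson atMost_iff sum.not_neutral_contains_not_neutral)
  moreover from this have "i' + j' + k' = d" "(i - i') + (j - j') + (k - k') = e"
    using assms unfolding homogeneous_def by (metis mult_eq_0_iff)+
  ultimately show "i + j + k = d + e" by linarith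
qed

lemma homogeneous_const: "homogeneous 0 [:[:[:c:]:]:]"
  by (auto simp: homogeneous_def coeff_pCons split: nat.splits)

lemma homogeneous_var: "homogeneous (Suc 0) varX" "homogeneous (Suc 0) varY" "homogeneous (Suc 0) varZ"
  by (auto simp: homogeneous_def coeff_pCons varX_def varY_def varZ_def split: nat.splits)

lemma homogeneous_1: "homogeneous 0 1"
  using homogeneous_const [of 1] by (simp add: one_pCons)

lemma homogeneous_power: "homogeneous d F \<Longrightarrow> homogeneous (n * d) (F ^ n)"
  by (induction n) (auto simp: homogeneous_1 homogeneous_mult)

lemma homogeneous_power1: "homogeneous (Suc 0) F \<Longrightarrow> homogeneous n (F ^ n)"
  using homogeneous_power [of "Suc 0" F n] by simp

lemma homogeneous_prod:
  "finite A \<Longrightarrow> (\<And>i. i \<in> A \<Longrightarrow> homogeneous (Suc 0) (f i)) \<Longrightarrow> homogeneous (card A) (prod f A)"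
proof (induction A rule: finite_induct)
  case (insert a A)
  then show ?case using homogeneous_mult [of "Suc 0" "f a" "card A" "prod f A"] by auto
qed (simp add: homogeneous_1)

definition linform :: "complex \<Rightarrow> complex \<Rightarrow> complex \<Rightarrow> poly3" where
  "linform a b c = smultC a varX + smultC b varY + smultC c varZ"

lemma ev_linform [simp]: "ev (linform a b c) x y z = a * x + b * y + c * z"
  by (simp add: linform_def)

lemma homogeneous_linform: "homogeneous (Suc 0) (linform a b c)"
  unfolding linform_def by (intro homogeneous_add homogeneous_smultC homogeneous_var)

lemma linform_neq_0: "(a, b, c) \<noteq> (0, 0, 0) \<Longrightarrow> linform a b c \<noteq> 0"
proof
  assume nz: "(a, b, c) \<noteq> (0, 0, 0)" and "linform a b c = 0"
  then have "a * x + b * y + c * z = 0" for x y z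
    by (metis ev_linform ev_simps(1))
  from this [of 1 0 0] this [of 0 1 0] this [of 0 0 1] nz show False by simp
qed

section \<open>The module of Jacobian syzygies\<close>

text \<open>Triples are treated as derivations of the polynomial ring; by \<open>AR_iff\<close> the
  syzygies of f are those that annihilate f.\<close>

definition der :: "poly3 \<Rightarrow> poly3 \<Rightarrow> poly3 \<Rightarrow> poly3 \<Rightarrow> poly3" where
  "der a b c F = a * derivX F + b * derivY F + c * derivZ F"

lemma der_mult: "der a b c (F * G) = der a b c F * G + F * der a b c G"
  by (simp add: der_def algebra_simps)

text \<open>Cofactors add up as for logarithmic derivatives, so the action on \<open>fA2 m\<close>
  is read off from its factors.\<close>

lemma der_eigen_mult:
  "der a b c F = u * F \<Longrightarrow> der a b c G = v * G \<Longrightarrow> der a b c (F * G) = (u + v) * (F * G)"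
  by (simp add: der_mult algebra_simps)

lemma der_diff_mult:
  "der (a - w * a') (b - w * b') (c - w * c') F = der a b c F - w * der a' b' c' F"
  by (simp add: der_def algebra_simps)

text \<open>Modulo F only one term of the Leibniz rule survives, and its factor G can be cancelled.
  Thus a derivation annihilating f preserves each coprime factor of f.\<close>

lemma dvd_of_der_mult_eq_0:
  assumes "der a b c (F * G) = 0" "coprime F G" shows "F dvd der a b c F"
proof -
  have "F dvd der a b c F * G"
    using assms(1) by (metis der_mult add_eq_0_iff2 dvd_minus_iff dvd_triv_left)
  with assms(2) show ?thesis
    by (simp add: coprime_dvd_mult_left_iff)
qed

text \<open>A common divisor is constant in the outer variable and divides every coefficient of G,
  in particular the unit one. This separates factors that involve the outer variable from those that
  do not.\<close>

lemma coprime_const_poly: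
  fixes f :: "'a::{factorial_ring_gcd,semiring_gcd_mult_normalize}"
  assumes "f \<noteq> 0" "is_unit (coeff G n)" shows "coprime [:f:] G"
proof (rule coprimeI)
  fix D assume D: "D dvd [:f:]" "D dvd G"
  from D(1) assms(1) have "degree D = 0"
    by (metis dvd_imp_degree_le degree_pCons_0 le_zero_eq pCons_eq_0_iff)
  then obtain d where d: "D = [:d:]" by (rule degree_eq_zeroE)
  with D(2) have "d dvd coeff G n" by (simp add: const_poly_dvd_iff)
  with assms(2) have "d dvd 1" by (blast intro: dvd_trans)
  with d show "is_unit D" by (simp add: is_unit_const_poly_iff)
qed

lemma coprime_const_polys:
  fixes f g :: "'a::{factorial_ring_gcd,semiring_gcd_mult_normalize}"
  assumes "f \<noteq> 0" "coprime f g" shows "coprime [:f:] [:g:]"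
proof (rule coprimeI)
  fix D assume D: "D dvd [:f:]" "D dvd [:g:]"
  from D(1) assms(1) have "degree D = 0"
    by (metis dvd_imp_degree_le degree_pCons_0 le_zero_eq pCons_eq_0_iff)
  then obtain d where d: "D = [:d:]" by (rule degree_eq_zeroE)
  with D assms(2) have "is_unit d" by (simp add: coprime_common_divisor)
  with d show "is_unit D" by (simp add: is_unit_const_poly_iff)
qed

lemma coprime_power_diff:
  fixes a b :: poly3
  assumes "coprime a b" "m > 0"
  shows "coprime a (a ^ m - b ^ m)" "coprime a (b ^ m - a ^ m)"
proof -
  have b: "coprime a (b ^ m)" using assms by simp
  have *: "is_unit D" if "D dvd a" "D dvd b ^ m" for D
    using that b by (blast intro: coprime_common_divisor)
  have a: "D dvd a ^ m" if "D dvd a" for D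
    using that assms(2) by (metis dvd_power dvd_trans)
  show "coprime a (a ^ m - b ^ m)"
  proof (rule coprimeI)
    fix D assume D: "D dvd a" "D dvd a ^ m - b ^ m"
    from dvd_diff [OF a [OF D(1)] D(2)] D(1) show "is_unit D" by (intro *) simp_all
  qed
  show "coprime a (b ^ m - a ^ m)"
  proof (rule coprimeI)
    fix D assume D: "D dvd a" "D dvd b ^ m - a ^ m"
    from dvd_add [OF a [OF D(1)] D(2)] D(1) show "is_unit D" by (intro *) simp_all
  qed
qed

lemma varZ_power: "varZ ^ m = monom 1 m"
  by (simp add: monom_altdef varZ_def)

lemma coeff_XY_power:
  "coeff (varX ^ m) n = (if n = 0 then [:[:0, 1:]:] ^ m else 0)"
  "coeff (varY ^ m) n = (if n = 0 then [:0, 1:] ^ m else 0)"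
  by (simp_all add: varX_def varY_def poly_const_pow coeff_pCons split: nat.splits)

lemma coprime_vars: "coprime varX varY" "coprime varX varZ" "coprime varY varZ"
proof -
  have "coprime [:[:0, 1::complex:]:] [:0, 1:]"
    by (rule coprime_const_poly [of _ _ 1]) auto
  then show "coprime varX varY"
    unfolding varX_def varY_def by (intro coprime_const_polys) auto
  show "coprime varX varZ" "coprime varY varZ"
    unfolding varX_def varY_def varZ_def by (rule coprime_const_poly [of _ _ 1]; simp)+
qed

text \<open>With z outermost, the first factor is a nonzero constant polynomial, while the other two
  have coefficient -1 or 1 at z^m.\<close>

lemma coprime_XY_power_diff:
  assumes "m > 0"
  shows "coprime (varX ^ m - varY ^ m) (varY ^ m - varZ ^ m)"
    "coprime (varX ^ m - varY ^ m) (varZ ^ m - varX ^ m)"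
proof -
  define f :: "complex poly poly" where "f = [:[:0, 1:]:] ^ m - [:0, 1:] ^ m"
  have P: "varX ^ m - varY ^ m = [:f:]"
    by (simp add: f_def varX_def varY_def poly_const_pow)
  have "ev (varX ^ m - varY ^ m) 1 0 0 = 1" using assms by simp
  then have "f \<noteq> 0" using P by auto
  then show "coprime (varX ^ m - varY ^ m) (varY ^ m - varZ ^ m)"
    "coprime (varX ^ m - varY ^ m) (varZ ^ m - varX ^ m)"
    unfolding P using assms
    by (auto intro!: coprime_const_poly [of _ _ m] simp: varZ_power coeff_XY_power)
qed

lemma vars_neq_0: "varX \<noteq> 0" "varY \<noteq> 0" "varZ \<noteq> 0"
  by (simp_all add: varX_def varY_def varZ_def)

lemma power_diff_vars_neq_0:
  assumes "m > 0"
  shows "varX ^ m - varY ^ m \<noteq> 0" "varY ^ m - varZ ^ m \<noteq> 0" "varZ ^ m - varX ^ m \<noteq> 0"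
proof -
  have "ev (varX ^ m - varY ^ m) 1 0 0 = 1" "ev (varY ^ m - varZ ^ m) 0 1 0 = 1"
    "ev (varZ ^ m - varX ^ m) 0 0 1 = 1"
    using assms by simp_all
  then show "varX ^ m - varY ^ m \<noteq> 0" "varY ^ m - varZ ^ m \<noteq> 0" "varZ ^ m - varX ^ m \<noteq> 0"
    by (metis ev_simps(1) zero_neq_one)+
qed

context
  fixes m :: nat
  assumes m: "m > 0"
begin

abbreviation (input) "XX \<equiv> varX ^ m"
abbreviation (input) "YY \<equiv> varY ^ m"
abbreviation (input) "ZZ \<equiv> varZ ^ m"
abbreviation (input) "PP \<equiv> varX ^ m - varY ^ m"
abbreviation (input) "QR \<equiv> (varY ^ m - varZ ^ m) * (varZ ^ m - varX ^ m)"

lemma homogeneous_derivZ: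
  assumes "homogeneous d F" shows "homogeneous (d - 1) (derivZ F)"
  unfolding homogeneous_def
proof (intro allI impI)
  fix i j k assume "coeff (coeff (coeff (derivZ F) k) j) i \<noteq> 0"
  then have "coeff (coeff (coeff F (Suc k)) j) i \<noteq> 0"
    by (auto simp: derivZ_def coeff_pderiv of_nat_poly)
  with assms have "i + j + Suc k = d" unfolding homogeneous_def by blast
  then show "i + j + k = d - 1" by simp
qed

lemma coprime_YZ_ZX: "coprime (YY - ZZ) (ZZ - XX)"
proof (rule coprimeI)
  fix D assume D: "D dvd YY - ZZ" "D dvd ZZ - XX"
  then have "D dvd (YY - ZZ) + (ZZ - XX)" by (rule dvd_add)
  then have "D dvd PP" by (subst dvd_minus_iff [symmetric]) simp
  with D(1) coprime_XY_power_diff(1) [OF m] show "is_unit D"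
    by (auto dest: coprime_common_divisor)
qed

lemma coprime_var_factors:
  "coprime varX PP" "coprime varX (YY - ZZ)" "coprime varX (ZZ - XX)"
  "coprime varY PP" "coprime varY (YY - ZZ)" "coprime varY (ZZ - XX)"
  "coprime varZ (YY - ZZ)" "coprime varZ (ZZ - XX)"
proof -
  have "coprime varX (YY - ZZ)" "coprime varY (ZZ - XX)"
    using m unfolding varX_def varY_def
    by (intro coprime_const_poly [of _ _ m];
        simp add: varZ_power coeff_XY_power flip: varX_def varY_def)+
  then show "coprime varX (YY - ZZ)" "coprime varY (ZZ - XX)" .
qed (use m coprime_vars in \<open>simp_all add: coprime_power_diff coprime_commute\<close>)

text \<open>Differentiating m-th powers produces factors m; being units over the complex numbers,
  they can be cancelled in divisibility statements.\<close>

lemma is_unit_of_nat: "is_unit (of_nat n :: poly3)" if "n > 0"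
proof -
  have "of_nat n * [:[:[:1 / of_nat n:]:]:] = (1 :: poly3)"
    by (rule poly3_eqI) (use that in \<open>simp del: mult_pCons_right\<close>)
  then show ?thesis by (metis dvd_triv_left)
qed

lemma AR_iff: "r \<in> AR f \<longleftrightarrow> der (r $ 1) (r $ 2) (r $ 3) f = 0"
  by (simp add: AR_def der_def)

lemma power_diff_decomp: "F ^ (m - 1) * F = F ^ m" for F :: poly3
  using m by (metis power_minus_mult mult.commute)

section \<open>The Euler derivation and theta on the factors\<close>

lemma der_euler_power_diff:
  "der varX varY varZ PP = of_nat m * PP"
  "der varX varY varZ (YY - ZZ) = of_nat m * (YY - ZZ)"
  "der varX varY varZ (ZZ - XX) = of_nat m * (ZZ - XX)"
proof -
  have *: "F * (of_nat m * F ^ (m - 1)) = of_nat m * F ^ m" for F :: poly3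
    by (simp add: mult_ac flip: power_diff_decomp [of F])
  show "der varX varY varZ PP = of_nat m * PP"
    "der varX varY varZ (YY - ZZ) = of_nat m * (YY - ZZ)"
    "der varX varY varZ (ZZ - XX) = of_nat m * (ZZ - XX)"
    unfolding der_def
    by (simp_all only: deriv3_diff deriv3_power deriv3_var mult_1_right mult_zero_right mult_minus_right
         * diff_0 diff_0_right minus_zero add_0_left add_0_right)
       (simp_all add: algebra_simps)
qed

text \<open>Theta sends x^m to m x^(2m), and a difference of squares is divisible by the
  difference.\<close>

lemma der_theta_power_diff:
  "der (varX ^ (m + 1)) (varY ^ (m + 1)) (varZ ^ (m + 1)) PP = of_nat m * (XX + YY) * PP"
  "der (varX ^ (m + 1)) (varY ^ (m + 1)) (varZ ^ (m + 1)) (YY - ZZ) = of_nat m * (YY + ZZ) * (YY - ZZ)"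
  "der (varX ^ (m + 1)) (varY ^ (m + 1)) (varZ ^ (m + 1)) (ZZ - XX) = of_nat m * (ZZ + XX) * (ZZ - XX)"
proof -
  have *: "F ^ (m + 1) * (of_nat m * F ^ (m - 1)) = of_nat m * (F ^ m * F ^ m)" for F :: poly3
    by (simp add: mult_ac flip: power_diff_decomp [of F])
  show "der (varX ^ (m + 1)) (varY ^ (m + 1)) (varZ ^ (m + 1)) PP = of_nat m * (XX + YY) * PP"
    "der (varX ^ (m + 1)) (varY ^ (m + 1)) (varZ ^ (m + 1)) (YY - ZZ) = of_nat m * (YY + ZZ) * (YY - ZZ)"
    "der (varX ^ (m + 1)) (varY ^ (m + 1)) (varZ ^ (m + 1)) (ZZ - XX) = of_nat m * (ZZ + XX) * (ZZ - XX)"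
    unfolding der_def
    by (simp_all only: deriv3_diff deriv3_power deriv3_var mult_1_right mult_zero_right mult_minus_right *
         diff_0 diff_0_right minus_zero add_0_left add_0_right)
       (simp_all add: algebra_simps)
qed

lemma der_euler_fA2: "der varX varY varZ (fA2 m) = of_nat (3 * m + 2) * fA2 m"
proof -
  have "der varX varY varZ varX = 1 * varX" "der varX varY varZ varY = 1 * varY"
    by (simp_all add: der_def)
  note this [THEN der_eigen_mult] this
  then have "der varX varY varZ (fA2 m) = (1 + 1 + of_nat m + of_nat m + of_nat m) * fA2 m"
    unfolding fA2_def by (intro der_eigen_mult der_euler_power_diff)
  then show ?thesis by (simp add: algebra_simps)
qed

lemma der_theta_fA2:
  "der (varX ^ (m + 1)) (varY ^ (m + 1)) (varZ ^ (m + 1)) (fA2 m) =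
    ((1 + 2 * of_nat m) * (XX + YY) + 2 * of_nat m * ZZ) * fA2 m"
proof -
  have "der (varX ^ (m + 1)) (varY ^ (m + 1)) (varZ ^ (m + 1)) varX = XX * varX"
    "der (varX ^ (m + 1)) (varY ^ (m + 1)) (varZ ^ (m + 1)) varY = YY * varY"
    by (simp_all add: der_def)
  then have "der (varX ^ (m + 1)) (varY ^ (m + 1)) (varZ ^ (m + 1)) (fA2 m) =
    (XX + YY + of_nat m * (XX + YY) + of_nat m * (YY + ZZ) + of_nat m * (ZZ + XX)) * fA2 m"
    unfolding fA2_def by (intro der_eigen_mult der_theta_power_diff)
  also have "XX + YY + of_nat m * (XX + YY) + of_nat m * (YY + ZZ) + of_nat m * (ZZ + XX) =
    (1 + 2 * of_nat m) * (XX + YY) + 2 * of_nat m * ZZ"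
    by (simp add: algebra_simps)
  finally show ?thesis .
qed

text \<open>Preserving x, y and \<open>PP\<close> fixes the first two components up to two
  polynomial parameters. Subtracting the corresponding multiples of the Euler derivation and of
  theta leaves a derivation in the z direction only; it must preserve the factors containing z,
  hence is a multiple of \<open>QR\<close>.\<close>

lemma der_fA2_decomposition:
  assumes "der a b c (fA2 m) = 0"
  obtains \<alpha> e \<gamma> where "a = \<alpha> * varX + e * varX ^ (m + 1)" "b = \<alpha> * varY + e * varY ^ (m + 1)"
    "c = \<alpha> * varZ + e * varZ ^ (m + 1) + \<gamma> * QR"
proof -
  note cp = coprime_var_factors coprime_vars coprime_XY_power_diff [OF m] coprime_YZ_ZX
  have "der a b c (varX * (varY * PP * (YY - ZZ) * (ZZ - XX))) = 0"
    using assms by (simp add: fA2_def mult_ac)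
  then have "varX dvd der a b c varX"
    by (rule dvd_of_der_mult_eq_0) (use cp in \<open>auto simp: coprime_commute\<close>)
  then have "varX dvd a" by (simp add: der_def)
  then obtain a' where a: "a = varX * a'" ..
  have "der a b c (varY * (varX * PP * (YY - ZZ) * (ZZ - XX))) = 0"
    using assms by (simp add: fA2_def mult_ac)
  then have "varY dvd der a b c varY"
    by (rule dvd_of_der_mult_eq_0) (use cp in \<open>auto simp: coprime_commute\<close>)
  then have "varY dvd b" by (simp add: der_def)
  then obtain b' where b: "b = varY * b'" ..
  have "der a b c (PP * (varX * varY * (YY - ZZ) * (ZZ - XX))) = 0"
    using assms by (simp add: fA2_def mult_ac)
  then have "PP dvd der a b c PP"
    by (rule dvd_of_der_mult_eq_0) (use cp in \<open>auto simp: coprime_commute\<close>)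
  also have "der a b c PP = of_nat m * (a' * (varX ^ (m - 1) * varX) - b' * (varY ^ (m - 1) * varY))"
    by (simp add: der_def a b algebra_simps)
  also have "\<dots> = of_nat m * (XX * (a' - b') + PP * b')"
    by (simp only: power_diff_decomp) (simp add: algebra_simps)
  finally have "PP dvd XX * (a' - b') + PP * b'"
    by (subst (asm) dvd_mult_unit_iff') (auto intro: is_unit_of_nat m)
  then have "PP dvd XX * (a' - b')"
    by (simp add: dvd_add_left_iff)
  then have "PP dvd a' - b'"
    by (subst (asm) coprime_dvd_mult_right_iff) (use cp m in \<open>auto simp: coprime_commute\<close>)
  then obtain e where e: "a' - b' = PP * e" ..
  \<comment> \<open>With \<open>b' = a' - PP * e\<close> this choice gives
    \<open>a' = \<alpha> + e * XX\<close> and \<open>b' = \<alpha> + e * YY\<close>, so both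
    components share the same parameters.\<close>
  define \<alpha> where "\<alpha> = a' - e * XX"
  have A: "a = \<alpha> * varX + e * varX ^ (m + 1)"
    by (simp add: a \<alpha>_def algebra_simps)
  have b': "b' = a' - PP * e" using e by (simp add: algebra_simps)
  have B: "b = \<alpha> * varY + e * varY ^ (m + 1)"
    by (simp add: b b' \<alpha>_def algebra_simps)
  define c' where "c' = c - \<alpha> * varZ - e * varZ ^ (m + 1)"
  \<comment> \<open>Both derivations multiply \<open>fA2 m\<close> by a polynomial, so the
    annihilation of \<open>fA2 m\<close> leaves a divisibility condition on the remaining component
    \<open>c'\<close> alone.\<close>
  have euler: "fA2 m dvd der varX varY varZ (fA2 m)"
    by (simp add: der_euler_fA2)
  have theta: "fA2 m dvd der (varX ^ (m + 1)) (varY ^ (m + 1)) (varZ ^ (m + 1)) (fA2 m)"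
    by (simp only: der_theta_fA2 dvd_triv_right)
  have "der a b c (fA2 m) = \<alpha> * der varX varY varZ (fA2 m)
     + e * der (varX ^ (m + 1)) (varY ^ (m + 1)) (varZ ^ (m + 1)) (fA2 m) + c' * derivZ (fA2 m)"
    unfolding der_def c'_def A B by (simp only: algebra_simps)
  with assms have "c' * derivZ (fA2 m) = - (\<alpha> * der varX varY varZ (fA2 m)
     + e * der (varX ^ (m + 1)) (varY ^ (m + 1)) (varZ ^ (m + 1)) (fA2 m))"
    by (simp add: add_eq_0_iff)
  then have "fA2 m dvd c' * derivZ (fA2 m)"
    using euler theta by (auto intro!: dvd_mult)
  also have "fA2 m = (varX * varY * PP) * QR"
    by (simp add: fA2_def mult_ac)
  also have "derivZ ((varX * varY * PP) * QR) = (varX * varY * PP) * derivZ QR"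
    by simp
  also have "c' * ((varX * varY * PP) * derivZ QR) = (varX * varY * PP) * (c' * derivZ QR)"
    by (simp add: mult_ac)
  finally have QR: "QR dvd c' * derivZ QR"
    using vars_neq_0 power_diff_vars_neq_0 [OF m] by simp
  have unit: "is_unit (of_nat m :: poly3)" by (rule is_unit_of_nat [OF m])
  have "YY - ZZ dvd c' * derivZ QR"
    using QR by (rule dvd_mult_left)
  \<comment> \<open>Modulo \<open>YY - ZZ\<close> only one term of the product rule remains, and its
    factors \<open>varZ ^ (m - 1)\<close> and \<open>ZZ - XX\<close> are coprime to
    \<open>YY - ZZ\<close>.\<close>
  also have "c' * derivZ QR = (YY - ZZ) * (c' * of_nat m * varZ ^ (m - 1))
      - of_nat m * (c' * (varZ ^ (m - 1) * (ZZ - XX)))"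
    by (simp add: algebra_simps)
  finally have "YY - ZZ dvd c' * (varZ ^ (m - 1) * (ZZ - XX))"
    using unit by (simp add: dvd_diff_right_iff dvd_mult_unit_iff')
  then have "YY - ZZ dvd c'"
    by (subst (asm) coprime_dvd_mult_left_iff) (use cp in \<open>simp_all add: coprime_commute\<close>)
  moreover have "ZZ - XX dvd c' * derivZ QR"
    using QR by (rule dvd_mult_right)
  then have "ZZ - XX dvd of_nat m * (c' * (varZ ^ (m - 1) * (YY - ZZ)))
      - (ZZ - XX) * (c' * of_nat m * varZ ^ (m - 1))"
    by (simp add: algebra_simps)
  then have "ZZ - XX dvd c' * (varZ ^ (m - 1) * (YY - ZZ))"
    using unit by (simp add: dvd_diff_left_iff dvd_mult_unit_iff')
  then have "ZZ - XX dvd c'"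
    by (subst (asm) coprime_dvd_mult_left_iff) (use cp in \<open>simp_all add: coprime_commute\<close>)
  ultimately have "QR dvd c'"
    using cp by (intro divides_mult)
  then obtain \<gamma> where "c' = QR * \<gamma>" ..
  then show ?thesis
    using A B by (intro that [of \<alpha> e \<gamma>]) (auto simp: c'_def algebra_simps)
qed

lemma free_fA2: "free_with_exponents (fA2 m) (m + 1) (2 * m)"
proof -
  define f where "f = fA2 m"
  \<comment> \<open>\<open>K\<close> inverts the Euler factor 3m + 2, the degree of f. If a
    derivation multiplies f by h, subtracting \<open>K * h\<close> times the Euler derivation yields
    a syzygy; \<open>h1\<close> and \<open>h2\<close> are the multipliers of theta and of (0, 0,
    g).\<close>
  define K :: poly3 where "K = [:[:[:1 / of_nat (3 * m + 2):]:]:]"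
  define h1 :: poly3 where "h1 = (1 + 2 * of_nat m) * (XX + YY) + 2 * of_nat m * ZZ"
  define g where "g = QR"
  define h2 where "h2 = derivZ g"
  \<comment> \<open>The zeros in \<open>s\<close> are written out so that
    \<open>der_diff_mult\<close> applies.\<close>
  define r s :: "poly3^3"
    where "r = vector [varX ^ (m + 1) - K * h1 * varX, varY ^ (m + 1) - K * h1 * varY, varZ ^ (m + 1) - K * h1 * varZ]"
      and "s = vector [0 - K * h2 * varX, 0 - K * h2 * varY, g - K * h2 * varZ]"
  have K: "K * of_nat (3 * m + 2) = 1"
  proof (rule poly3_eqI)
    have "complex_of_nat (3 * m + 2) \<noteq> 0" by (metis of_nat_eq_0_iff add_is_0 zero_neq_numeral)
    then show "ev (K * of_nat (3 * m + 2)) x y z = ev 1 x y z" for x y z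
      unfolding K_def by (simp del: mult_pCons_left of_nat_add of_nat_mult)
  qed
  have hom_K: "homogeneous 0 K" unfolding K_def by (rule homogeneous_const)
  have hom_nat: "homogeneous 0 (of_nat n)" for n
    using homogeneous_const [of "of_nat n"] by (simp add: of_nat_poly)
  have hom_diff: "homogeneous m (YY - ZZ)" "homogeneous m (ZZ - XX)"
    by (intro homogeneous_diff homogeneous_power1 homogeneous_var)+
  have hom_QR: "homogeneous (2 * m) QR"
    using homogeneous_mult [OF hom_diff] by (simp add: mult_2)
  have "homogeneous (0 + m) (of_nat (1 + 2 * m) * (XX + YY) + of_nat (2 * m) * ZZ)"
    by (intro homogeneous_add homogeneous_mult hom_nat homogeneous_power1 homogeneous_var)
  then have hom_h1: "homogeneous (0 + m) h1"
    by (simp add: h1_def)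
  have hom_h2: "homogeneous (0 + (2 * m - 1)) h2"
    unfolding h2_def g_def using homogeneous_derivZ [OF hom_QR] by simp
  have f_g: "f = varX * varY * PP * g"
    by (simp only: f_def fA2_def g_def mult.assoc)
  have f_z: "derivZ f = varX * varY * PP * h2"
    by (simp add: f_g h2_def)
  have f0: "f \<noteq> 0"
    using vars_neq_0 power_diff_vars_neq_0 [OF m] by (simp add: f_g g_def)
  have E: "der varX varY varZ f = of_nat (3 * m + 2) * f"
    unfolding f_def by (rule der_euler_fA2)
  have T: "der (varX ^ (m + 1)) (varY ^ (m + 1)) (varZ ^ (m + 1)) f = h1 * f"
    unfolding f_def h1_def by (rule der_theta_fA2)
  have r_AR: "r \<in> AR f"
  proof -
    have "der (r $ 1) (r $ 2) (r $ 3) f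
      = der (varX ^ (m + 1)) (varY ^ (m + 1)) (varZ ^ (m + 1)) f - K * h1 * der varX varY varZ f"
      by (simp add: r_def der_diff_mult)
    also have "\<dots> = 0"
      unfolding E T using K by (simp add: mult_ac del: of_nat_add of_nat_mult)
    finally show ?thesis by (simp add: AR_iff)
  qed
  have s_AR: "s \<in> AR f"
  proof -
    have "der (s $ 1) (s $ 2) (s $ 3) f = der 0 0 g f - K * h2 * der varX varY varZ f"
      by (simp only: s_def der_diff_mult vector_3)
    also have "der 0 0 g f = h2 * f"
      by (simp add: der_def f_z) (simp add: f_g mult_ac)
    also have "h2 * f - K * h2 * der varX varY varZ f = 0"
      unfolding E using K by (simp add: mult_ac del: of_nat_add of_nat_mult)
    finally show ?thesis by (simp add: AR_iff)
  qed
  have indep: "u = 0 \<and> v = 0" if uv: "u *s r + v *s s = 0" for u v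
  proof -
    have c: "u * r $ i + v * s $ i = 0" for i
      using uv by (metis vector_add_component vector_smult_component zero_index)
    \<comment> \<open>\<open>w\<close> gathers all Euler corrections. The x and y components of the
      relation give \<open>u * XX = w = u * YY\<close>, which forces u = 0.\<close>
    define w where "w = K * (u * h1 + v * h2)"
    have 1: "u * varX ^ (m + 1) = w * varX" using c [of 1] by (simp add: r_def s_def w_def algebra_simps)
    have 2: "u * varY ^ (m + 1) = w * varY" using c [of 2] by (simp add: r_def s_def w_def algebra_simps)
    have 3: "u * varZ ^ (m + 1) + v * g = w * varZ" using c [of 3] by (simp add: r_def s_def w_def algebra_simps)
    from 1 2 have "u * XX = w" "u * YY = w" using vars_neq_0 by auto
    then have "u * PP = 0" by (simp add: algebra_simps)
    then have u: "u = 0" using power_diff_vars_neq_0 [OF m] by simp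
    with 1 have "w = 0" using vars_neq_0 by simp
    with u 3 show ?thesis using power_diff_vars_neq_0 [OF m] by (simp add: g_def)
  qed
  have rs: "r \<noteq> s"
  proof
    assume "r = s"
    then have "1 *s r + (- 1) *s s = 0" by (simp add: vec_eq_iff)
    then show False using indep by fastforce
  qed
  interpret M: module "(*s) :: poly3 \<Rightarrow> poly3^3 \<Rightarrow> poly3^3" by (rule module_poly3_vec)
  have ind: "\<not> M.dependent {r, s}"
  proof
    assume "M.dependent {r, s}"
    then obtain u where u: "u r \<noteq> 0 \<or> u s \<noteq> 0" "u r *s r + u s *s s = 0"
      using rs by (subst (asm) M.dependent_finite) auto
    with indep show False by blast
  qed
  have span: "M.span {r, s} = AR f"
  proof
    have "M.subspace (AR f)"
    proof (rule M.subspaceI)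
      fix u v assume "u \<in> AR f" "v \<in> AR f"
      moreover have "der ((u + v) $ 1) ((u + v) $ 2) ((u + v) $ 3) f =
          der (u $ 1) (u $ 2) (u $ 3) f + der (v $ 1) (v $ 2) (v $ 3) f"
        by (simp add: der_def distrib_right)
      ultimately show "u + v \<in> AR f" by (simp only: AR_iff add_0_left mult_zero_right)
    next
      fix k u assume "u \<in> AR f"
      moreover have "der ((k *s u) $ 1) ((k *s u) $ 2) ((k *s u) $ 3) f = k * der (u $ 1) (u $ 2) (u $ 3) f"
        by (simp add: der_def distrib_left mult.assoc)
      ultimately show "k *s u \<in> AR f" by (simp only: AR_iff add_0_left mult_zero_right)
    qed (simp add: AR_iff der_def)
    with r_AR s_AR show "M.span {r, s} \<subseteq> AR f"
      by (intro M.span_minimal) auto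
  next
    show "AR f \<subseteq> M.span {r, s}"
    proof
      fix t assume "t \<in> AR f"
      then have t: "der (t $ 1) (t $ 2) (t $ 3) f = 0" by (simp add: AR_iff)
      then obtain \<alpha> e \<gamma> where d: "t $ 1 = \<alpha> * varX + e * varX ^ (m + 1)" "t $ 2 = \<alpha> * varY + e * varY ^ (m + 1)"
        "t $ 3 = \<alpha> * varZ + e * varZ ^ (m + 1) + \<gamma> * g"
        unfolding f_def g_def by (rule der_fA2_decomposition)
      \<comment> \<open>\<open>w\<close> is the Euler coefficient left over when t is rewritten in
        terms of r and s. These three annihilate f and the Euler derivation does not, so
        \<open>w\<close> vanishes.\<close>
      define w where "w = \<alpha> + K * (e * h1 + \<gamma> * h2)"
      have c: "t $ 1 = w * varX + e * r $ 1 + \<gamma> * s $ 1" "t $ 2 = w * varY + e * r $ 2 + \<gamma> * s $ 2"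
        "t $ 3 = w * varZ + e * r $ 3 + \<gamma> * s $ 3"
        unfolding d w_def r_def s_def by (simp_all add: algebra_simps)
      have "der (t $ 1) (t $ 2) (t $ 3) f = w * der varX varY varZ f
          + e * der (r $ 1) (r $ 2) (r $ 3) f + \<gamma> * der (s $ 1) (s $ 2) (s $ 3) f"
        unfolding c der_def by (simp add: algebra_simps)
      with t r_AR s_AR have "w * (of_nat (3 * m + 2) * f) = 0"
        by (simp add: AR_iff E del: of_nat_add of_nat_mult)
      then have "w = 0"
        using f0 K by (metis mult_eq_0_iff mult_zero_right zero_neq_one)
      with c have "t = e *s r + \<gamma> *s s"
        by (simp add: vec_eq_iff forall_3)
      moreover have "r \<in> M.span {r, s}" "s \<in> M.span {r, s}"
        by (simp_all add: M.span_base)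
      ultimately show "t \<in> M.span {r, s}"
        by (simp only: M.span_add M.span_scale)
    qed
  qed
  have hom_r: "homogeneous (m + 1) (r $ i)" for i
  proof -
    have "homogeneous (m + 1) (v ^ (m + 1) - K * h1 * v)" if "homogeneous (Suc 0) v" for v
      using homogeneous_mult [OF homogeneous_mult [OF hom_K hom_h1] that] that
      by (intro homogeneous_diff homogeneous_power1) simp_all
    then show ?thesis
      using exhaust_3 [of i] homogeneous_var by (auto simp: r_def)
  qed
  have hom_s: "homogeneous (2 * m) (s $ i)" for i
  proof -
    have "homogeneous (2 * m) (K * h2 * v)" if "homogeneous (Suc 0) v" for v
      using homogeneous_mult [OF homogeneous_mult [OF hom_K hom_h2] that] m by simp
    then have "homogeneous (2 * m) (s $ 1)" "homogeneous (2 * m) (s $ 2)" "homogeneous (2 * m) (s $ 3)"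
      unfolding s_def vector_3 g_def
      by (blast intro: homogeneous_diff homogeneous_0 homogeneous_var hom_QR)+
    then show ?thesis
      using exhaust_3 [of i] by metis
  qed
  show ?thesis
    unfolding free_with_exponents_def f_def [symmetric]
    using rs hom_r hom_s ind span by blast
qed

end

section \<open>Lines, dual points and modular points\<close>

lemma vec3_eq_iff: "v = vector [a, b, c] \<longleftrightarrow> v $ 1 = a \<and> v $ 2 = b \<and> v $ 3 = c" for v :: "complex^3"
  by (auto simp: vec_eq_iff forall_3)

lemma abs_proj_plane_eq_iff:
  assumes "u \<noteq> 0" "v \<noteq> 0"
  shows "abs_proj_plane u = abs_proj_plane v \<longleftrightarrow> (\<exists>c. v = c *s u)"
proof -
  have "proportional w w" if "w \<noteq> 0" for w
    using that by (auto simp: proportional_def intro: exI [of _ 1])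
  then have "abs_proj_plane u = abs_proj_plane v \<longleftrightarrow> proportional u v"
    using Quotient3_rel [OF Quotient3_proj_plane, of u v] assms by blast
  with assms show ?thesis by (simp add: proportional_def)
qed

lemma pt_cases:
  obtains a b c where "p = pt a b c" "(a, b, c) \<noteq> (0, 0, 0)"
proof -
  define v where "v = rep_proj_plane p"
  have "proportional v v"
    unfolding v_def by (rule Quotient3_rep_reflp [OF Quotient3_proj_plane])
  then have "v \<noteq> 0" by (simp add: proportional_def)
  have "v = vector [v $ 1, v $ 2, v $ 3]" by (simp add: vec3_eq_iff)
  moreover have "p = abs_proj_plane v"
    unfolding v_def by (simp add: Quotient3_abs_rep [OF Quotient3_proj_plane])
  ultimately have "p = pt (v $ 1) (v $ 2) (v $ 3)" by (simp add: pt_def)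
  moreover have "(v $ 1, v $ 2, v $ 3) \<noteq> (0, 0, 0)"
    using \<open>v \<noteq> 0\<close> by (auto simp: vec_eq_iff forall_3)
  ultimately show thesis by (rule that)
qed

lemma vector_neq_0: "(a, b, c) \<noteq> (0, 0, 0) \<Longrightarrow> (vector [a, b, c] :: complex^3) \<noteq> 0"
  by (auto simp: vec_eq_iff forall_3)

lemma hcoords_pt:
  assumes "(a, b, c) \<noteq> (0, 0, 0)"
  shows "hcoords (pt a b c) = {vector [k * a, k * b, k * c] | k. k \<noteq> 0}"
proof -
  have "v \<noteq> 0 \<and> abs_proj_plane v = pt a b c \<longleftrightarrow> (\<exists>k. v = vector [k * a, k * b, k * c] \<and> k \<noteq> 0)" for v
  proof
    assume v: "v \<noteq> 0 \<and> abs_proj_plane v = pt a b c"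
    then obtain k where "v = k *s vector [a, b, c]"
      using abs_proj_plane_eq_iff [of "vector [a, b, c]" v] vector_neq_0 [OF assms]
      by (auto simp: pt_def)
    with v show "\<exists>k. v = vector [k * a, k * b, k * c] \<and> k \<noteq> 0"
      by (intro exI [of _ k]) (auto simp: vec3_eq_iff)
  next
    assume "\<exists>k. v = vector [k * a, k * b, k * c] \<and> k \<noteq> 0"
    then obtain k where k: "v = k *s vector [a, b, c]" "k \<noteq> 0"
      by (auto simp: vec_eq_iff forall_3)
    then have "v \<noteq> 0" using vector_neq_0 [OF assms] by simp
    with k show "v \<noteq> 0 \<and> abs_proj_plane v = pt a b c"
      using abs_proj_plane_eq_iff [of "vector [a, b, c]" v] vector_neq_0 [OF assms]
      by (auto simp: pt_def)
  qed
  then show ?thesis by (auto simp: hcoords_def)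
qed

lemma pt_eq_iff:
  assumes "(a, b, c) \<noteq> (0, 0, 0)" "(x, y, z) \<noteq> (0, 0, 0)"
  shows "pt a b c = pt x y z \<longleftrightarrow> (\<exists>k. x = k * a \<and> y = k * b \<and> z = k * c)"
  using abs_proj_plane_eq_iff [OF vector_neq_0 vector_neq_0, OF assms]
  by (simp add: pt_def vec_eq_iff forall_3)

lemma vanishes_at_pt:
  assumes "homogeneous d F" "(a, b, c) \<noteq> (0, 0, 0)"
  shows "vanishes_at F (pt a b c) \<longleftrightarrow> ev F a b c = 0"
proof -
  have "ev F (1 * a) (1 * b) (1 * c) = 0" if "\<forall>k. k \<noteq> 0 \<longrightarrow> ev F (k * a) (k * b) (k * c) = 0"
    using that zero_neq_one by metis
  then show ?thesis
    by (auto simp: vanishes_at_def hcoords_pt [OF assms(2)] eval3_vector ev_homogeneous [OF assms(1)])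
qed

lemma pt_in_dual_line:
  assumes "(a, b, c) \<noteq> (0, 0, 0)" "(x, y, z) \<noteq> (0, 0, 0)"
  shows "pt x y z \<in> dual_line (pt a b c) \<longleftrightarrow> a * x + b * y + c * z = 0"
proof -
  have *: "k * a * (l * x) + k * b * (l * y) + k * c * (l * z) = k * l * (a * x + b * y + c * z)" for k l
    by (simp add: algebra_simps)
  have "vector [a, b, c] \<in> hcoords (pt a b c)" "vector [x, y, z] \<in> hcoords (pt x y z)"
    using assms [THEN vector_neq_0] by (simp_all add: hcoords_def pt_def)
  moreover have "u $ 1 * v $ 1 + u $ 2 * v $ 2 + u $ 3 * v $ 3 = 0"
    if "u \<in> hcoords (pt a b c)" "v \<in> hcoords (pt x y z)" "a * x + b * y + c * z = 0" for u v :: "complex^3"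
    using that * by (auto simp: hcoords_pt [OF assms(1)] hcoords_pt [OF assms(2)])
  ultimately show ?thesis
    unfolding dual_line_def mem_Collect_eq by (metis vector_3)
qed

lemma arrangement_eq: "arrangement f = dual_line ` dual_points (arrangement f)"
  by (auto simp: dual_points_def arrangement_def)

lemma pt_in_dual_points:
  assumes "homogeneous d f" "d > 0" "(a, b, c) \<noteq> (0, 0, 0)"
  shows "pt a b c \<in> dual_points (arrangement f) \<longleftrightarrow> (\<forall>x y z. a * x + b * y + c * z = 0 \<longrightarrow> ev f x y z = 0)"
proof -
  \<comment> \<open>The right-hand side also ranges over (0, 0, 0), which is no projective point;
    positivity of the degree covers it.\<close>
  have 0: "ev f 0 0 0 = 0"
    using ev_homogeneous [OF assms(1), of 0 0 0 0] assms(2) by (simp add: power_0_left)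
  have "pt a b c \<in> dual_points (arrangement f) \<longleftrightarrow> (\<forall>q\<in>dual_line (pt a b c). vanishes_at f q)"
    by (auto simp: dual_points_def arrangement_def)
  also have "\<dots> \<longleftrightarrow> (\<forall>x y z. a * x + b * y + c * z = 0 \<longrightarrow> ev f x y z = 0)"
  proof safe
    fix x y z assume *: "\<forall>q\<in>dual_line (pt a b c). vanishes_at f q" "a * x + b * y + c * z = 0"
    show "ev f x y z = 0"
    proof (cases "(x, y, z) = (0, 0, 0)")
      case False
      with * show ?thesis
        using pt_in_dual_line [OF assms(3) False] vanishes_at_pt [OF assms(1) False] by blast
    qed (use 0 in simp)
  next
    fix q assume *: "\<forall>x y z. a * x + b * y + c * z = 0 \<longrightarrow> ev f x y z = 0" "q \<in> dual_line (pt a b c)"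
    obtain x y z where q: "q = pt x y z" "(x, y, z) \<noteq> (0, 0, 0)" by (rule pt_cases)
    with * show "vanishes_at f q"
      using pt_in_dual_line [OF assms(3) q(2)] vanishes_at_pt [OF assms(1) q(2)] by blast
  qed
  finally show ?thesis .
qed

section \<open>The lines of the arrangement\<close>

lemma homogeneous_fA2: "homogeneous (3 * m + 2) (fA2 m)"
proof -
  have "homogeneous (Suc 0 + Suc 0 + m + m + m) (fA2 m)" (is "homogeneous ?d _")
    unfolding fA2_def
    by (intro homogeneous_mult homogeneous_diff homogeneous_power1 homogeneous_var)
  also have "?d = 3 * m + 2" by simp
  finally show ?thesis .
qed

lemma ev_fA2: "ev (fA2 m) x y z = x * y * (x ^ m - y ^ m) * (y ^ m - z ^ m) * (z ^ m - x ^ m)"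
  by (simp add: fA2_def)

text \<open>The clauses describe the lines through (0:0:1), those of y^m = z^m and those of z^m =
  x^m. The signs come from the solution (b : -a) of a x + b y = 0, and m-th powers avoid a choice of
  roots of unity.\<close>

definition dual_fA2 :: "nat \<Rightarrow> complex \<Rightarrow> complex \<Rightarrow> complex \<Rightarrow> bool" where
  "dual_fA2 m a b c \<longleftrightarrow> c = 0 \<and> (a = 0 \<or> b = 0 \<or> b ^ m = (- a) ^ m) \<or>
     a = 0 \<and> (- b) ^ m = c ^ m \<or> b = 0 \<and> (- a) ^ m = c ^ m"

lemma power_divide_eq_1_iff: "c \<noteq> 0 \<Longrightarrow> (u / c) ^ m = 1 \<longleftrightarrow> u ^ m = c ^ m" for c u :: complex
  by (simp add: power_divide)

lemma dual_points_fA2: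
  assumes m: "m > 0" and nz: "(a, b, c) \<noteq> (0, 0, 0)"
  shows "pt a b c \<in> dual_points (arrangement (fA2 m)) \<longleftrightarrow> dual_fA2 m a b c"
proof -
  have "(\<forall>x y z. a * x + b * y + c * z = 0 \<longrightarrow> ev (fA2 m) x y z = 0) \<longleftrightarrow> dual_fA2 m a b c"
  proof
    assume *: "\<forall>x y z. a * x + b * y + c * z = 0 \<longrightarrow> ev (fA2 m) x y z = 0"
    show "dual_fA2 m a b c"
    proof (cases "c = 0")
      case True
      \<comment> \<open>The point (b : -a : z) lies on the line for every z. A choice of z for which
        the two factors containing z are nonzero forces one of the others to vanish.\<close>
      have "finite ({z. z ^ m = (- a) ^ m} \<union> {z. z ^ m = b ^ m})"
        using finite_nth_roots [OF m] by simp
      then obtain z where "z \<notin> {z. z ^ m = (- a) ^ m} \<union> {z. z ^ m = b ^ m}"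
        using ex_new_if_finite [OF infinite_UNIV_complex] by blast
      moreover have "ev (fA2 m) b (- a) z = 0"
        using * True by simp
      ultimately show ?thesis
        using True by (auto simp: ev_fA2 dual_fA2_def)
    next
      case False
      \<comment> \<open>For c nonzero the line contains all points (t : 1 : l(t)). Along them the
        product of the factors of \<open>fA2 m\<close> is the zero polynomial in t, so one factor
        vanishes identically.\<close>
      define l where "l = [:- b / c, - a / c:]"
      define p1 p2 p3 where "p1 = [:0, 1:] ^ m - (1 :: complex poly)" and "p2 = 1 - l ^ m" and "p3 = l ^ m - [:0, 1:] ^ m"
      have "poly ([:0, 1:] * p1 * p2 * p3) t = 0" for t
      proof -
        have "a * t + b * 1 + c * poly l t = 0"
          using False by (simp add: l_def field_simps)
        with * have "ev (fA2 m) t 1 (poly l t) = 0" by blast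
        then show ?thesis
          by (simp add: ev_fA2 p1_def p2_def p3_def)
      qed
      then have "[:0, 1:] * p1 * p2 * p3 = 0"
        using poly_all_0_iff_0 by blast
      moreover have "poly p1 0 \<noteq> 0" using m by (simp add: p1_def power_0_left)
      then have "p1 \<noteq> 0" by auto
      ultimately have "p2 = 0 \<or> p3 = 0" by simp
      then show ?thesis
      proof
        assume p2: "p2 = 0"
        have "a = 0"
        proof (rule ccontr)
          assume "a \<noteq> 0"
          then have "poly l (- b / a) = 0" using False by (simp add: l_def field_simps)
          then have "poly p2 (- b / a) = 1" using m by (simp add: p2_def power_0_left)
          with p2 show False by simp
        qed
        moreover have "poly p2 0 = 0" using p2 by simp
        then have "(- b / c) ^ m = 1" by (simp add: p2_def l_def)
        then have "(- b) ^ m = c ^ m" using False by (metis power_divide_eq_1_iff)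
        ultimately show ?thesis by (simp add: dual_fA2_def)
      next
        assume p3: "p3 = 0"
        then have "poly p3 0 = 0" "poly p3 1 = 0" by simp_all
        then have "(- b / c) ^ m = 0" "(- b / c + - a / c) ^ m = 1"
          using m by (simp_all add: p3_def l_def power_0_left)
        then have "b = 0" and "(- a / c) ^ m = 1" using False by auto
        then have "(- a) ^ m = c ^ m" using False by (metis power_divide_eq_1_iff)
        with \<open>b = 0\<close> show ?thesis by (simp add: dual_fA2_def)
      qed
    qed
  next
    assume Z: "dual_fA2 m a b c"
    show "\<forall>x y z. a * x + b * y + c * z = 0 \<longrightarrow> ev (fA2 m) x y z = 0"
    proof (intro allI impI)
      fix x y z assume l: "a * x + b * y + c * z = 0"
      from Z consider "c = 0" "a = 0 \<or> b = 0 \<or> b ^ m = (- a) ^ m" | "a = 0" "(- b) ^ m = c ^ m" | "b = 0" "(- a) ^ m = c ^ m"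
        unfolding dual_fA2_def by blast
      then show "ev (fA2 m) x y z = 0"
      proof cases
        case 1
        from 1(2) show ?thesis
        proof (elim disjE)
          assume ab: "b ^ m = (- a) ^ m"
          from l 1 have "- a * x = b * y" by (simp add: add_eq_0_iff)
          then have "(- a) ^ m * x ^ m = b ^ m * y ^ m" by (metis power_mult_distrib)
          moreover have "a \<noteq> 0" using ab nz 1 m by (auto simp: power_0_left)
          ultimately show ?thesis using ab by (simp add: ev_fA2)
        qed (use l 1 nz in \<open>auto simp: ev_fA2\<close>)
      next
        case 2
        then have "c \<noteq> 0" "- b * y = c * z" using nz l m by (auto simp: add_eq_0_iff power_0_left)
        then have "(- b) ^ m * y ^ m = c ^ m * z ^ m" "c ^ m \<noteq> 0" by (metis power_mult_distrib, simp)
        with 2 have "y ^ m = z ^ m" by (metis mult_left_cancel)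
        then show ?thesis by (simp add: ev_fA2)
      next
        case 3
        then have "c \<noteq> 0" "- a * x = c * z" using nz l m by (auto simp: add_eq_0_iff power_0_left)
        then have "(- a) ^ m * x ^ m = c ^ m * z ^ m" "c ^ m \<noteq> 0" by (metis power_mult_distrib, simp)
        with 3 have "x ^ m = z ^ m" by (metis mult_left_cancel)
        then show ?thesis by (simp add: ev_fA2)
      qed
    qed
  qed
  then show ?thesis
    using pt_in_dual_points [OF homogeneous_fA2 _ nz] by simp
qed

lemma line_in_arrangement_fA2:
  assumes "m > 0"
  shows "L \<in> arrangement (fA2 m) \<longleftrightarrow>
    (\<exists>a b c. (a, b, c) \<noteq> (0, 0, 0) \<and> dual_fA2 m a b c \<and> L = dual_line (pt a b c))"
proof
  assume "L \<in> arrangement (fA2 m)"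
  then obtain p where p: "p \<in> dual_points (arrangement (fA2 m))" "L = dual_line p"
    by (subst (asm) arrangement_eq) blast
  obtain a b c where "p = pt a b c" "(a, b, c) \<noteq> (0, 0, 0)" by (rule pt_cases)
  with p dual_points_fA2 [OF assms] show "\<exists>a b c. (a, b, c) \<noteq> (0, 0, 0) \<and> dual_fA2 m a b c \<and> L = dual_line (pt a b c)"
    by blast
next
  assume "\<exists>a b c. (a, b, c) \<noteq> (0, 0, 0) \<and> dual_fA2 m a b c \<and> L = dual_line (pt a b c)"
  then show "L \<in> arrangement (fA2 m)"
    using dual_points_fA2 [OF assms] by (subst arrangement_eq) blast
qed

text \<open>Joins with intersection points on the lines x = 0 and y = 0 reduce a modular point other
  than (0:0:1) to (1:0:0) or (0:1:0), and these two are excluded because their join z = 0 is not in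
  the arrangement. The argument compares two distinct m-th roots of unity; for m = 1 the point
  (1:1:1) is modular as well.\<close>

lemma modular_fA2_unique:
  assumes m: "m \<ge> 2" and mod: "modular_point (arrangement (fA2 m)) p" shows "p = pt 0 0 1"
proof -
  let ?A = "arrangement (fA2 m)"
  have m0: "m > 0" using m by simp
  obtain x y z where p: "p = pt x y z" and nz: "(x, y, z) \<noteq> (0, 0, 0)" by (rule pt_cases)
  \<comment> \<open>The point (u:v:w) lies on the first line only and witnesses that the two lines
    differ.\<close>
  have int: "pt x' y' z' \<in> intersection_points ?A"
    if "dual_fA2 m a b c" "dual_fA2 m a' b' c'" "(a, b, c) \<noteq> (0, 0, 0)" "(a', b', c') \<noteq> (0, 0, 0)"
       "(x', y', z') \<noteq> (0, 0, 0)"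
      "a * x' + b * y' + c * z' = 0" "a' * x' + b' * y' + c' * z' = 0"
      "(u, v, w) \<noteq> (0, 0, 0)" "a * u + b * v + c * w = 0" "a' * u + b' * v + c' * w \<noteq> 0"
    for a b c a' b' c' x' y' z' u v w
  proof -
    let ?L = "dual_line (pt a b c)" and ?M = "dual_line (pt a' b' c')"
    have "?L \<in> ?A" "?M \<in> ?A"
      unfolding line_in_arrangement_fA2 [OF m0] using that(1-4) by blast+
    moreover have "pt u v w \<in> ?L" "pt u v w \<notin> ?M" "pt x' y' z' \<in> ?L" "pt x' y' z' \<in> ?M"
      using that(6,7,9,10) pt_in_dual_line [OF that(3,8)] pt_in_dual_line [OF that(4,8)]
        pt_in_dual_line [OF that(3,5)] pt_in_dual_line [OF that(4,5)] by blast+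
    ultimately show ?thesis
      unfolding intersection_points_def by blast
  qed
  have join: "\<exists>a b c. (a, b, c) \<noteq> (0, 0, 0) \<and> dual_fA2 m a b c \<and> a * x + b * y + c * z = 0 \<and> a * x' + b * y' + c * z' = 0"
    if "pt x' y' z' \<in> intersection_points ?A" "(x', y', z') \<noteq> (0, 0, 0)" "\<not> (\<exists>k. x = k * x' \<and> y = k * y' \<and> z = k * z')"
    for x' y' z'
  proof -
    have "pt x' y' z' \<noteq> p" using that(3) pt_eq_iff [OF that(2) nz] p by simp
    with that(1) mod obtain L where "L \<in> ?A" "p \<in> L" "pt x' y' z' \<in> L"
      unfolding modular_point_def by blast
    from this(1) obtain a b c where L: "(a, b, c) \<noteq> (0, 0, 0)" "dual_fA2 m a b c" "L = dual_line (pt a b c)"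
      unfolding line_in_arrangement_fA2 [OF m0] by blast
    with \<open>p \<in> L\<close> \<open>pt x' y' z' \<in> L\<close> show ?thesis
      using pt_in_dual_line [OF L(1) nz] pt_in_dual_line [OF L(1) that(2)] p by blast
  qed
  have "card {\<xi>. \<xi> ^ m = (1::complex)} = m" by (rule card_roots_unity_eq) (use m in simp)
  then have "\<not> {\<xi>. \<xi> ^ m = (1::complex)} \<subseteq> {1}"
    using m card_mono [of "{1::complex}" "{\<xi>. \<xi> ^ m = 1}"] by auto
  then obtain \<xi> :: complex where xi: "\<xi> ^ m = 1" "\<xi> \<noteq> 1" by auto
  have "x = 0 \<and> y = 0"
  proof (rule ccontr)
    assume xy: "\<not> (x = 0 \<and> y = 0)"
    show False
    proof (cases "x = 0")
      case False
      \<comment> \<open>The only lines of the arrangement through (0:1:\<zeta>) are x = 0, which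
        misses p, and z = \<zeta> y.\<close>
      have z: "z = \<zeta> * y" if "\<zeta> ^ m = 1" for \<zeta>
      proof -
        have "\<zeta> \<noteq> 0" using that m by (auto simp: power_0_left)
        have "pt 0 1 \<zeta> \<in> intersection_points ?A"
          using m that by (intro int [of 1 0 0 0 "- \<zeta>" 1 _ _ _ 0 1 0]) (auto simp: dual_fA2_def \<open>\<zeta> \<noteq> 0\<close>)
        from join [OF this] False obtain a b c where abc: "(a, b, c) \<noteq> (0, 0, 0)" "dual_fA2 m a b c"
          "a * x + b * y + c * z = 0" "b + c * \<zeta> = 0" by auto
        have "a = 0" using abc m \<open>\<zeta> \<noteq> 0\<close> False by (auto simp: dual_fA2_def power_0_left split: if_splits)
        with abc have "c \<noteq> 0" "b = - (c * \<zeta>)" by (auto simp: add_eq_0_iff2)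
        with abc(3) \<open>a = 0\<close> have "c * (z - \<zeta> * y) = 0" by (simp add: algebra_simps)
        with \<open>c \<noteq> 0\<close> show ?thesis by simp
      qed
      from z [OF xi(1)] z [of 1] xi(2) have "y = 0" "z = 0" by auto
      have "pt 0 1 0 \<in> intersection_points ?A"
        using m by (intro int [of 1 0 0 "- 1" 0 1 _ _ _ 0 0 1]) (auto simp: dual_fA2_def)
      from join [OF this] False obtain a b c where abc: "(a, b, c) \<noteq> (0, 0, 0)" "dual_fA2 m a b c"
          "a * x + b * y + c * z = 0" "b = 0" by auto
      with \<open>y = 0\<close> \<open>z = 0\<close> False m show False by (auto simp: dual_fA2_def power_0_left)
    next
      case True
      with xy have y: "y \<noteq> 0" by simp
      \<comment> \<open>The only lines of the arrangement through (1:0:1) are y = 0, which misses p,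
        and x = z, which contains p only for z = 0.\<close>
      have "pt 1 0 1 \<in> intersection_points ?A"
        using m by (intro int [of 0 1 0 "- 1" 0 1 _ _ _ 1 0 0]) (auto simp: dual_fA2_def)
      from join [OF this] y obtain a b c where abc: "(a, b, c) \<noteq> (0, 0, 0)" "dual_fA2 m a b c"
        "a * x + b * y + c * z = 0" "a + c = 0" by auto
      then have "z = 0"
        using y True m by (auto simp: dual_fA2_def power_0_left split: if_splits)
      have "pt 1 0 0 \<in> intersection_points ?A"
        using m by (intro int [of 0 1 0 0 "- 1" 1 _ _ _ 0 0 1]) (auto simp: dual_fA2_def)
      from join [OF this] y obtain a b c where abc: "(a, b, c) \<noteq> (0, 0, 0)" "dual_fA2 m a b c"
          "a * x + b * y + c * z = 0" "a = 0" by auto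
      with \<open>x = 0\<close> \<open>z = 0\<close> y m show False by (auto simp: dual_fA2_def power_0_left)
    qed
  qed
  with p nz show ?thesis using pt_eq_iff [of 0 0 1 x y z] by auto
qed

text \<open>A line missing (0:0:1) belongs to y^m = z^m or to z^m = x^m. Two of the first kind meet
  where y = 0, two of the second where x = 0, and one of each where x^m = y^m; in every case the
  join with (0:0:1) is in the arrangement.\<close>

lemma modular_fA2:
  assumes m: "m > 0" shows "modular_point (arrangement (fA2 m)) (pt 0 0 1)"
  unfolding modular_point_def
proof (intro conjI ballI impI)
  let ?A = "arrangement (fA2 m)"
  have "pt 1 0 0 \<noteq> pt 0 1 0" by (subst pt_eq_iff) auto
  have lines: "dual_line (pt 1 0 0) \<in> ?A" "dual_line (pt 0 1 0) \<in> ?A"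
    unfolding line_in_arrangement_fA2 [OF m]
    by (metis dual_fA2_def zero_neq_one prod.inject)+
  have "pt 0 1 0 \<in> dual_line (pt 1 0 0)" "pt 0 1 0 \<notin> dual_line (pt 0 1 0)"
    "pt 0 0 1 \<in> dual_line (pt 1 0 0)" "pt 0 0 1 \<in> dual_line (pt 0 1 0)"
    by (simp_all add: pt_in_dual_line)
  with lines show "pt 0 0 1 \<in> intersection_points ?A"
    unfolding intersection_points_def by blast
  fix p' assume p': "p' \<in> intersection_points ?A" "p' \<noteq> pt 0 0 1"
  obtain x y z where p: "p' = pt x y z" and nz: "(x, y, z) \<noteq> (0, 0, 0)" by (rule pt_cases)
  have xy: "(y, - x, 0) \<noteq> (0, 0, 0)"
    using p' p nz pt_eq_iff [of 0 0 1 x y z] by auto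
  from p' obtain L M where LM: "L \<in> ?A" "M \<in> ?A" "L \<noteq> M" "p' \<in> L" "p' \<in> M"
    unfolding intersection_points_def by blast
  from LM(1) obtain a b c where L: "(a, b, c) \<noteq> (0, 0, 0)" "dual_fA2 m a b c" "L = dual_line (pt a b c)"
    using line_in_arrangement_fA2 [OF m] by blast
  from LM(2) obtain a' b' c' where M: "(a', b', c') \<noteq> (0, 0, 0)" "dual_fA2 m a' b' c'" "M = dual_line (pt a' b' c')"
    using line_in_arrangement_fA2 [OF m] by blast
  have l: "a * x + b * y + c * z = 0" "a' * x + b' * y + c' * z = 0"
    using LM p L M nz pt_in_dual_line by blast+
  show "\<exists>L\<in>?A. pt 0 0 1 \<in> L \<and> p' \<in> L"
  proof (cases "c = 0 \<or> c' = 0")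
    case True
    then show ?thesis
    proof
      assume "c = 0"
      with L LM show ?thesis by (intro bexI [of _ L]) (auto simp: pt_in_dual_line)
    next
      assume "c' = 0"
      with M LM show ?thesis by (intro bexI [of _ M]) (auto simp: pt_in_dual_line)
    qed
  next
    case False
    then have c: "c \<noteq> 0" "c' \<noteq> 0" by auto
    have neq: "\<not> (\<exists>k. a' = k * a \<and> b' = k * b \<and> c' = k * c)"
      using LM(3) L M pt_eq_iff [OF L(1) M(1)] by auto
    have type1: "y ^ m = z ^ m" if "a = 0" "(- b) ^ m = c ^ m" "c \<noteq> 0" "a * x + b * y + c * z = 0" for a b c
    proof -
      have "- b * y = c * z" using that by (simp add: add_eq_0_iff)
      then have "(- b) ^ m * y ^ m = c ^ m * z ^ m" by (metis power_mult_distrib)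
      with that show ?thesis by simp
    qed
    have type2: "x ^ m = z ^ m" if "b = 0" "(- a) ^ m = c ^ m" "c \<noteq> 0" "a * x + b * y + c * z = 0" for a b c
    proof -
      have "- a * x = c * z" using that by (simp add: add_eq_0_iff)
      then have "(- a) ^ m * x ^ m = c ^ m * z ^ m" by (metis power_mult_distrib)
      with that show ?thesis by simp
    qed
    \<comment> \<open>By the determinant of the two equations in t and z: if t is nonzero, the lines
      are proportional, with ratio c' / c.\<close>
    have indep: "t = 0 \<or> (\<exists>k. u' = k * u \<and> c' = k * c)" if "u * t + c * z = 0" "u' * t + c' * z = 0" for t u u'
    proof -
      have "t * (c' * u - c * u') = c' * (u * t + c * z) - c * (u' * t + c' * z)"
        by (simp add: algebra_simps)
      with that have "t = 0 \<or> c' * u = c * u'" by simp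
      then show ?thesis
        using c by (auto intro!: exI [of _ "c' / c"] simp: field_simps)
    qed
    consider "a = 0" "(- b) ^ m = c ^ m" | "b = 0" "(- a) ^ m = c ^ m"
      using L(2) c by (auto simp: dual_fA2_def)
    then have "x = 0 \<or> y = 0 \<or> x ^ m = y ^ m"
    proof cases
      case 1
      consider "a' = 0" "(- b') ^ m = c' ^ m" | "b' = 0" "(- a') ^ m = c' ^ m"
        using M(2) c by (auto simp: dual_fA2_def)
      then show ?thesis
      proof cases
        case 1
        with \<open>a = 0\<close> l indep [of b y b'] neq show ?thesis by auto
      next
        case 2
        with type2 [OF 2 c(2) l(2)] type1 [OF \<open>a = 0\<close> \<open>(- b) ^ m = c ^ m\<close> c(1) l(1)] show ?thesis by simp
      qed
    next
      case 2
      consider "a' = 0" "(- b') ^ m = c' ^ m" | "b' = 0" "(- a') ^ m = c' ^ m"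
        using M(2) c by (auto simp: dual_fA2_def)
      then show ?thesis
      proof cases
        case 2
        with \<open>b = 0\<close> l indep [of a x a'] neq show ?thesis by auto
      next
        case 1
        with type1 [OF 1 c(2) l(2)] type2 [OF \<open>b = 0\<close> \<open>(- a) ^ m = c ^ m\<close> c(1) l(1)] show ?thesis by simp
      qed
    qed
    then have "dual_fA2 m y (- x) 0"
      by (auto simp: dual_fA2_def power_minus [of x] power_minus [of y])
    then have "dual_line (pt y (- x) 0) \<in> ?A"
      using line_in_arrangement_fA2 [OF m] xy by blast
    moreover have "pt 0 0 1 \<in> dual_line (pt y (- x) 0)" "p' \<in> dual_line (pt y (- x) 0)"
      using xy nz by (auto simp: p pt_in_dual_line)
    ultimately show ?thesis by blast
  qed
qed

section \<open>Orders of vanishing, projection from a point, generic points\<close>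

text \<open>The recursion suits an inductive product rule better than the fixed order of
  differentiations in \<open>vanishes_to_order\<close>.\<close>

fun vord :: "nat \<Rightarrow> poly3 \<Rightarrow> complex \<Rightarrow> complex \<Rightarrow> complex \<Rightarrow> bool" where
  "vord 0 F x y z \<longleftrightarrow> True"
| "vord (Suc n) F x y z \<longleftrightarrow> ev F x y z = 0 \<and>
     vord n (derivX F) x y z \<and> vord n (derivY F) x y z \<and> vord n (derivZ F) x y z"

lemma vord_Suc_D: "vord (Suc n) F x y z \<Longrightarrow> vord n F x y z"
proof (induction n arbitrary: F)
  case (Suc n)
  then have "ev F x y z = 0 \<and> vord n (derivX F) x y z \<and> vord n (derivY F) x y z \<and> vord n (derivZ F) x y z"
    unfolding vord.simps(2) [of "Suc n"] by blast
  then show ?case by simp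
qed simp

lemma vord_add: "vord n F x y z \<Longrightarrow> vord n G x y z \<Longrightarrow> vord n (F + G) x y z"
  by (induction n arbitrary: F G) auto

lemma vord_mult: "vord m F x y z \<Longrightarrow> vord n G x y z \<Longrightarrow> vord (m + n) (F * G) x y z"
proof (induction "m + n" arbitrary: m n F G)
  case (Suc k)
  \<comment> \<open>D and E stand for partials of F and G. Differentiation lowers the order of one
    factor by one; if that order is 0, the order of the other factor is weakened instead.\<close>
  have step: "vord k (D * G + F * E) x y z"
    if "\<And>m'. m = Suc m' \<Longrightarrow> vord m' D x y z" "\<And>n'. n = Suc n' \<Longrightarrow> vord n' E x y z" for D E
  proof (rule vord_add)
    show "vord k (D * G) x y z"
    proof (cases m)
      case 0
      then have "vord (0 + k) (D * G) x y z"
        using Suc by (intro Suc.hyps(1)) (auto intro: vord_Suc_D)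
      then show ?thesis by simp
    next
      case (Suc m')
      then have "vord (m' + n) (D * G) x y z"
        using Suc.hyps Suc.prems that by (intro Suc.hyps(1)) auto
      then show ?thesis using Suc Suc.hyps(2) by simp
    qed
    show "vord k (F * E) x y z"
    proof (cases n)
      case 0
      then have "vord (k + 0) (F * E) x y z"
        using Suc by (intro Suc.hyps(1)) (auto intro: vord_Suc_D)
      then show ?thesis by simp
    next
      case (Suc n')
      then have "vord (m + n') (F * E) x y z"
        using Suc.hyps Suc.prems that by (intro Suc.hyps(1)) auto
      then show ?thesis using Suc Suc.hyps(2) by simp
    qed
  qed
  have "ev (F * G) x y z = 0"
    using Suc.hyps(2) Suc.prems by (cases m; cases n) auto
  moreover have "vord k (derivX (F * G)) x y z" "vord k (derivY (F * G)) x y z" "vord k (derivZ (F * G)) x y z"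
    unfolding deriv3_mult using Suc.prems by (intro step; simp)+
  ultimately show ?case
    by (simp flip: Suc.hyps(2))
qed simp

lemma vord_power: "ev F x y z = 0 \<Longrightarrow> vord n (F ^ n) x y z"
proof (induction n)
  case (Suc n)
  have "vord (Suc 0 + n) (F * F ^ n) x y z"
    using Suc by (intro vord_mult) auto
  then show ?case by simp
qed simp

lemma vord_funpow:
  "vord (n + i) F x y z \<Longrightarrow> vord n ((derivX ^^ i) F) x y z"
  "vord (n + i) F x y z \<Longrightarrow> vord n ((derivY ^^ i) F) x y z"
  "vord (n + i) F x y z \<Longrightarrow> vord n ((derivZ ^^ i) F) x y z"
  by (induction i arbitrary: n) (simp_all, (metis add_Suc vord.simps(2))+)

lemma vanishes_to_orderI:
  assumes "\<And>v. v \<in> hcoords q \<Longrightarrow> vord n F (v $ 1) (v $ 2) (v $ 3)"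
  shows "vanishes_to_order n F q"
  unfolding vanishes_to_order_def vanishes_at_def eval3_eq_ev
proof (intro allI impI ballI)
  fix i j k and v :: "complex^3" assume "i + j + k < n" "v \<in> hcoords q"
  then have "\<exists>l. n = Suc (l + i + j + k)" by (metis add.commute add.left_commute less_iff_Suc_add)
  then obtain l where "n = Suc l + i + j + k" by auto
  with assms [OF \<open>v \<in> hcoords q\<close>]
  have "vord (Suc l) ((derivX ^^ i) ((derivY ^^ j) ((derivZ ^^ k) F))) (v $ 1) (v $ 2) (v $ 3)"
    by (intro vord_funpow) simp
  then show "ev ((derivX ^^ i) ((derivY ^^ j) ((derivZ ^^ k) F))) (v $ 1) (v $ 2) (v $ 3) = 0"
    by simp
qed

text \<open>The change of coordinates that carries the behaviour at (a:b:1) to (0:0:1). It is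
  specified by its values, which determine a polynomial; \<open>ev_shift\<close> supplies
  existence.\<close>

definition shift :: "complex \<Rightarrow> complex \<Rightarrow> poly3 \<Rightarrow> poly3" where
  "shift a b F = (THE G. \<forall>x y z. ev G x y z = ev F (x + a * z) (y + b * z) z)"

lemma ev_shift [simp]: "ev (shift a b F) x y z = ev F (x + a * z) (y + b * z) z"
proof -
  have "\<exists>G. \<forall>x y z. ev G x y z = ev F (x + a * z) (y + b * z) z"
  proof (rule poly3_induct [of _ F], goal_cases const X Y Z add mult)
    case (const c) show ?case by (rule exI [of _ "[:[:[:c:]:]:]"]) simp
  next
    case X show ?case by (rule exI [of _ "varX + smultC a varZ"]) simp
  next
    case Y show ?case by (rule exI [of _ "varY + smultC b varZ"]) simp
  next
    case Z show ?case by (rule exI [of _ varZ]) simp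
  next
    case (add F G) then show ?case by (metis ev_simps(3))
  next
    case (mult F G) then show ?case by (metis ev_simps(6))
  qed
  then have "\<exists>!G. \<forall>x y z. ev G x y z = ev F (x + a * z) (y + b * z) z"
    by (auto intro: poly3_eqI)
  from theI' [OF this] show ?thesis
    unfolding shift_def by blast
qed

lemma shift_mult: "shift a b (F * G) = shift a b F * shift a b G"
  by (rule poly3_eqI) simp

lemma shift_uminus_shift: "shift (- a) (- b) (shift a b F) = F"
  by (rule poly3_eqI) simp

lemma shift_1: "shift a b 1 = 1"
  by (rule poly3_eqI) simp

lemma shift_0: "shift a b 0 = 0"
  by (rule poly3_eqI) simp

lemma shift_inject: "shift a b F = shift a b G \<longleftrightarrow> F = G"
  by (metis shift_uminus_shift)

text \<open>Units and factorisations are transported by the multiplicative bijection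
  \<open>shift a b\<close>, whose inverse is \<open>shift (- a) (- b)\<close>.\<close>

lemma irreducible_shift_D:
  assumes "irreducible (shift a b F)" shows "irreducible F"
proof (rule irreducibleI)
  show "F \<noteq> 0" using assms shift_0 by (metis irreducible_def)
  have unit: "is_unit G" if u: "is_unit (shift a b G)" for G
  proof -
    from u obtain H where "1 = shift a b G * H" by (rule dvdE)
    then have "shift (- a) (- b) 1 = shift (- a) (- b) (shift a b G * H)" by simp
    then have "shift (- a) (- b) 1 = G * shift (- a) (- b) H"
      by (simp only: shift_mult shift_uminus_shift)
    then show ?thesis unfolding shift_1 by (rule dvdI)
  qed
  have "is_unit (shift a b F)" if "is_unit F"
    using that by (metis dvd_def shift_1 shift_mult)
  then show "\<not> is_unit F" using assms by (auto simp: irreducible_def)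
  fix G H assume "F = G * H"
  then have "shift a b F = shift a b G * shift a b H" by (simp add: shift_mult)
  with assms have "is_unit (shift a b G) \<or> is_unit (shift a b H)"
    by (rule irreducibleD)
  with unit show "is_unit G \<or> is_unit H" by blast
qed

lemma derivX_shift: "derivX (shift a b F) = shift a b (derivX F)"
proof (rule derivX_eqI)
  fix x y z
  have "((\<lambda>x. x + a * z) has_field_derivative 1) (at x)" by (auto intro!: derivative_eq_intros)
  from DERIV_chain2 [OF DERIV_ev_X this]
  show "((\<lambda>x. ev (shift a b F) x y z) has_field_derivative ev (shift a b (derivX F)) x y z) (at x)"
    by simp
qed

lemma derivY_shift: "derivY (shift a b F) = shift a b (derivY F)"
proof (rule derivY_eqI)
  fix x y z
  have "((\<lambda>y. y + b * z) has_field_derivative 1) (at y)" by (auto intro!: derivative_eq_intros)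
  from DERIV_chain2 [OF DERIV_ev_Y this]
  show "((\<lambda>y. ev (shift a b F) x y z) has_field_derivative ev (shift a b (derivY F)) x y z) (at y)"
    by simp
qed

lemma funpow_derivXY_shift:
  "(derivX ^^ i) ((derivY ^^ j) (shift a b F)) = shift a b ((derivX ^^ i) ((derivY ^^ j) F))"
proof -
  have "(derivY ^^ j) (shift a b F) = shift a b ((derivY ^^ j) F)" for F
    by (induction j) (auto simp: derivY_shift)
  moreover have "(derivX ^^ i) (shift a b F) = shift a b ((derivX ^^ i) F)" for F
    by (induction i) (auto simp: derivX_shift)
  ultimately show ?thesis by simp
qed

lemma homogeneous_shift:
  assumes "homogeneous d F" shows "homogeneous d (shift a b F)"
proof -
  let ?S = "SIGMA i:{..d}. {..d - i}"
  let ?c = "\<lambda>i j. coeff (coeff (coeff F (d - i - j)) j) i"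
  let ?M = "\<lambda>i j. linform 1 0 a ^ i * linform 0 1 b ^ j * linform 0 0 1 ^ (d - i - j)"
  have "shift a b F = (\<Sum>(i, j)\<in>?S. smultC (?c i j) (?M i j))"
  proof (rule poly3_eqI)
    fix x y z
    have "ev (shift a b F) x y z = ev F (x + a * z) (y + b * z) z" by simp
    also have "\<dots> = ev (\<Sum>(i, j)\<in>?S. smultC (?c i j) (?M i j)) x y z"
      by (subst homogeneous_sum_mono [OF assms]) (simp add: case_prod_beta monomial3_eq)
    finally show "ev (shift a b F) x y z = ev (\<Sum>(i, j)\<in>?S. smultC (?c i j) (?M i j)) x y z" .
  qed
  moreover have "homogeneous d (?M i j)" if "i \<le> d" "j \<le> d - i" for i j
  proof -
    have "homogeneous (i + j + (d - i - j)) (?M i j)"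
      by (intro homogeneous_mult homogeneous_power1 homogeneous_linform)
    with that show ?thesis by simp
  qed
  ultimately show ?thesis
    by (auto intro!: homogeneous_sum homogeneous_smultC)
qed

lemma coeff_funpow_map_poly:
  fixes f :: "'a::zero \<Rightarrow> 'a"
  assumes "f 0 = 0" shows "coeff ((map_poly f ^^ n) p) k = (f ^^ n) (coeff p k)"
  by (induction n) (simp_all add: coeff_map_poly [where f = f, OF assms])

lemma coeff_funpow_derivXY:
  "coeff (coeff (coeff ((derivX ^^ i) ((derivY ^^ j) F)) k) 0) 0
    = fact i * fact j * coeff (coeff (coeff F k) j) i"
proof -
  have "coeff (coeff (coeff ((derivX ^^ i) G) k) l) 0 = fact i * coeff (coeff (coeff G k) l) i" for G l
    by (simp add: derivX_def coeff_funpow_map_poly coeff_higher_pderiv flip: pochhammer_fact)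
  moreover have "coeff (coeff ((derivY ^^ j) F) k) 0 = fact j * coeff (coeff F k) j"
    by (simp add: derivY_def coeff_funpow_map_poly coeff_higher_pderiv flip: pochhammer_fact)
  moreover have "(fact j :: complex poly) = [:fact j:]"
    by (metis of_nat_fact of_nat_poly)
  ultimately show ?thesis by simp
qed

text \<open>Evaluation at (0, 0, 1) sums the coefficients of x^i y^j z^k over all k, up to the
  factor i! j!; homogeneity leaves the single term k = d - i - j.\<close>

lemma coeff_eq_0_of_vanishing:
  assumes F: "homogeneous d F" and ij: "i + j \<le> d"
    and ev: "ev ((derivX ^^ i) ((derivY ^^ j) F)) 0 0 1 = 0"
  shows "coeff (coeff (coeff F (d - i - j)) j) i = 0"
proof -
  define H where "H = (derivX ^^ i) ((derivY ^^ j) F)"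
  define N where "N = max (degree H) d"
  have "ev H 0 0 1 = coeff (coeff (poly H 1) 0) 0"
    by (simp add: ev_def poly_0_coeff_0 flip: one_pCons)
  also have "poly H 1 = (\<Sum>k\<le>N. coeff H k)"
    unfolding poly_altdef power_one mult_1_right
    by (rule sum.mono_neutral_left) (auto simp: N_def coeff_eq_0)
  also have "coeff (coeff (\<Sum>k\<le>N. coeff H k) 0) 0 = (\<Sum>k\<le>N. fact i * fact j * coeff (coeff (coeff F k) j) i)"
    unfolding coeff_sum H_def coeff_funpow_derivXY ..
  also have "\<dots> = (\<Sum>k\<in>{d - i - j}. fact i * fact j * coeff (coeff (coeff F k) j) i)"
  proof (rule sum.mono_neutral_right)
    show "\<forall>k\<in>{..N} - {d - i - j}. fact i * fact j * coeff (coeff (coeff F k) j) i = 0"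
    proof
      fix k assume "k \<in> {..N} - {d - i - j}"
      then have "i + j + k \<noteq> d" by auto
      with F have "coeff (coeff (coeff F k) j) i = 0" unfolding homogeneous_def by blast
      then show "fact i * fact j * coeff (coeff (coeff F k) j) i = 0" by simp
    qed
  qed (auto simp: N_def)
  finally show ?thesis
    using ev by (simp add: H_def)
qed

text \<open>After the shift, a monomial with z-exponent at least 2 has degree less than d - 1 in x
  and y, which the multiplicity forbids. Hence the form is linear in z, with coefficients of degree
  d and d - 1.\<close>

lemma shift_normal_form:
  assumes F: "homogeneous d F" and van: "vanishes_to_order (d - 1) F (pt a b 1)"
  obtains A B where "shift a b F = [:A, B:]"
    "\<And>i j. coeff (coeff A j) i \<noteq> 0 \<Longrightarrow> i + j = d" "\<And>i j. coeff (coeff B j) i \<noteq> 0 \<Longrightarrow> i + j + 1 = d"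
proof -
  define G where "G = shift a b F"
  have G: "homogeneous d G" unfolding G_def by (rule homogeneous_shift [OF F])
  have "vector [a, b, 1] \<in> hcoords (pt a b 1)"
    using vector_neq_0 [of a b 1] by (simp add: hcoords_def pt_def)
  then have "ev ((derivX ^^ i) ((derivY ^^ j) F)) a b 1 = 0" if "i + j < d - 1" for i j
    using van [unfolded vanishes_to_order_def vanishes_at_def, rule_format, of i j 0 "vector [a, b, 1]"] that
    by (simp add: eval3_eq_ev)
  then have "ev ((derivX ^^ i) ((derivY ^^ j) G)) 0 0 1 = 0" if "i + j < d - 1" for i j
    using that by (simp add: G_def funpow_derivXY_shift)
  then have 0: "coeff (coeff (coeff G (d - i - j)) j) i = 0" if "i + j < d - 1" for i j
    using that by (intro coeff_eq_0_of_vanishing [OF G]) auto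
  have "coeff G k = 0" if "k > 1" for k
  proof (intro poly_eqI, rule ccontr)
    fix i j assume "coeff (coeff (coeff G k) j) i \<noteq> coeff (coeff 0 j) i"
    then have *: "coeff (coeff (coeff G k) j) i \<noteq> 0" by simp
    with G have "i + j + k = d" unfolding homogeneous_def by blast
    then have "i + j < d - 1" "d - i - j = k" using that by simp_all
    with 0 [of i j] * show False by simp
  qed
  then have "G = [:coeff G 0, coeff G 1:]"
    by (intro poly_eqI) (auto simp: coeff_pCons split: nat.splits)
  moreover have "i + j = d" if "coeff (coeff (coeff G 0) j) i \<noteq> 0" for i j
    using that G unfolding homogeneous_def by fastforce
  moreover have "i + j + 1 = d" if "coeff (coeff (coeff G 1) j) i \<noteq> 0" for i j
    using that G unfolding homogeneous_def by blast
  ultimately show ?thesis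
    using that unfolding G_def by blast
qed

text \<open>By the fundamental theorem of algebra a nonconstant polynomial in two variables has a
  zero off the origin: for positive degree in y fix a nonzero x off the roots of the leading
  coefficient, otherwise take y = 1. Coprimality thus reduces to the absence of common
  zeros.\<close>

lemma is_unit_of_zeros:
  fixes h :: "complex poly poly"
  assumes zeros: "\<And>x y. poly (poly h [:y:]) x = 0 \<Longrightarrow> x = 0 \<and> y = 0"
  shows "is_unit h"
proof -
  have "degree h = 0"
  proof (rule ccontr)
    assume deg: "degree h \<noteq> 0"
    define l where "l = lead_coeff h"
    have "l \<noteq> 0" using deg by (auto simp: l_def)
    then have "finite (insert 0 {x. poly l x = 0})" by (simp add: poly_roots_finite)
    then obtain x where x: "x \<noteq> 0" "poly l x \<noteq> 0"
      using ex_new_if_finite [OF infinite_UNIV_complex] by blast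
    define g where "g = map_poly (\<lambda>p. poly p x) h"
    have g: "poly g y = poly (poly h [:y:]) x" for y
      unfolding g_def by (induction h) (auto simp: map_poly_pCons)
    have "coeff g (degree h) \<noteq> 0" using x by (simp add: g_def coeff_map_poly l_def)
    then have "degree g \<noteq> 0" using deg le_degree [of g "degree h"] by auto
    then obtain y where "poly g y = 0"
      by (metis constant_degree fundamental_theorem_of_algebra)
    then have "poly (poly h [:y:]) x = 0" using g by metis
    then have "x = 0" using zeros by blast
    with x show False by simp
  qed
  then obtain p where p: "h = [:p:]" by (rule degree_eq_zeroE)
  have "degree p = 0"
  proof (rule ccontr)
    assume "degree p \<noteq> 0"
    then obtain x where "poly p x = 0"
      by (metis constant_degree fundamental_theorem_of_algebra)
    then have "poly (poly h [:1:]) x = 0" by (simp add: p)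
    then have "(1 :: complex) = 0" using zeros by blast
    then show False by simp
  qed
  then obtain c where c: "p = [:c:]" by (rule degree_eq_zeroE)
  have "c \<noteq> 0"
  proof
    assume "c = 0"
    then have "poly (poly h [:1:]) 1 = 0" by (simp add: p c)
    then have "(1 :: complex) = 0" using zeros by blast
    then show False by simp
  qed
  with p c show ?thesis by (simp add: is_unit_const_poly_iff dvd_field_iff)
qed

text \<open>The degrees of two factors add up to 1, so one of them is constant in the outer
  variable; it divides both coefficients and is a unit by coprimality.\<close>

lemma irreducible_linear_poly:
  fixes A B :: "'a :: {factorial_ring_gcd,semiring_gcd_mult_normalize}"
  assumes "coprime A B" "B \<noteq> 0" shows "irreducible [:A, B:]"
proof (rule irreducibleI)
  show "[:A, B:] \<noteq> 0" using assms by simp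
  show "\<not> is_unit [:A, B:]" using assms by (simp add: is_unit_poly_iff)
  have const: "is_unit p" if "[:A, B:] = p * q" "degree p = 0" for p q
  proof -
    from that(2) obtain h where h: "p = [:h:]" by (rule degree_eq_zeroE)
    with that(1) have "[:h:] dvd [:A, B:]" by (metis dvd_triv_left)
    then have "h dvd coeff [:A, B:] n" for n by (simp only: const_poly_dvd_iff)
    from this [of 0] this [of 1] have "h dvd A" "h dvd B" by simp_all
    with assms(1) have "is_unit h" by (rule coprime_common_divisor)
    with h show ?thesis by (simp add: is_unit_const_poly_iff)
  qed
  fix p q assume pq: "[:A, B:] = p * q"
  with assms have "p \<noteq> 0" "q \<noteq> 0" by auto
  with pq have "degree p + degree q = 1"
    using degree_mult_eq [of p q] assms(2) by (simp flip: pq)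
  then have "degree p = 0 \<or> degree q = 0" by auto
  then show "is_unit p \<or> is_unit q"
    using const [OF pq] const [of q p] pq by (auto simp: mult.commute)
qed

section \<open>Generic points\<close>

lemma genericI_linear:
  assumes "finite W" "(0, 0, 0) \<notin> W"
  shows "generic (\<lambda>q. \<exists>a b. q = pt a b 1 \<and> (\<forall>(u, v, w)\<in>W. u * a + v * b + w \<noteq> 0))"
proof -
  \<comment> \<open>Avoiding the added line z = 0 guarantees a representative (a:b:1).\<close>
  let ?W = "insert (0, 0, 1) W"
  define G where "G = (\<Prod>(u, v, w)\<in>?W. linform u v w)"
  have G: "homogeneous (card ?W) G"
    unfolding G_def by (rule homogeneous_prod) (use assms in \<open>auto simp: homogeneous_linform\<close>)
  have "G \<noteq> 0"
  proof -
    have "linform u v w \<noteq> 0" if "(u, v, w) \<in> ?W" for u v w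
      by (rule linform_neq_0) (use assms that in auto)
    then show ?thesis
      unfolding G_def using assms(1) by (subst prod_zero_iff) auto
  qed
  have evG: "ev G x y z = (\<Prod>(u, v, w)\<in>?W. u * x + v * y + w * z)" for x y z
    by (simp add: G_def case_prod_beta del: prod.insert)
  define U where "U = {q. \<not> vanishes_at G q}"
  have "- U = {q. \<forall>F\<in>{G}. vanishes_at F q}" by (auto simp: U_def)
  then have "zariski_closed (- U)"
    unfolding zariski_closed_def using G by blast
  moreover have "U \<noteq> {}"
  proof -
    obtain x y z where xyz: "ev G x y z \<noteq> 0" using \<open>G \<noteq> 0\<close> by (rule poly3_nonzero_point)
    then have "z \<noteq> 0" using assms(1) by (auto simp: evG)
    then have "\<not> vanishes_at G (pt x y z)"
      using xyz by (subst vanishes_at_pt [OF G]) auto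
    then show ?thesis by (auto simp: U_def)
  qed
  moreover have "\<exists>a b. q = pt a b 1 \<and> (\<forall>(u, v, w)\<in>W. u * a + v * b + w \<noteq> 0)" if "q \<in> U" for q
  proof -
    obtain x y z where q: "q = pt x y z" "(x, y, z) \<noteq> (0, 0, 0)" by (rule pt_cases)
    with that have "ev G x y z \<noteq> 0"
      using vanishes_at_pt [OF G q(2)] by (simp add: U_def)
    then have nz: "\<forall>(u, v, w)\<in>?W. u * x + v * y + w * z \<noteq> 0"
      unfolding evG using assms(1) by (subst (asm) prod_zero_iff) auto
    then have z: "z \<noteq> 0" by auto
    then have "q = pt (x / z) (y / z) 1"
      unfolding q(1) by (subst pt_eq_iff) (auto intro: exI [of _ "1 / z"])
    moreover have "u * (x / z) + v * (y / z) + w \<noteq> 0" if "(u, v, w) \<in> W" for u v w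
    proof -
      have "u * (x / z) + v * (y / z) + w = (u * x + v * y + w * z) / z"
        using z by (simp add: field_simps)
      moreover have "u * x + v * y + w * z \<noteq> 0" using nz that by auto
      ultimately show ?thesis using z by (simp only: divide_eq_0_iff) simp
    qed
    ultimately show ?thesis by blast
  qed
  ultimately show ?thesis
    unfolding generic_def by blast
qed

lemma generic_mono: "generic P \<Longrightarrow> (\<And>q. P q \<Longrightarrow> Q q) \<Longrightarrow> generic Q"
  unfolding generic_def by blast

text \<open>A nonempty open set contains the complement of the zero locus of a single form: take a
  defining form that does not vanish at some point of the set.\<close>

lemma generic_nonvanishing:
  assumes "generic P"
  shows "\<exists>d F. homogeneous d F \<and> F \<noteq> 0 \<and> (\<forall>q. \<not> vanishes_at F q \<longrightarrow> P q)"
proof -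
  obtain U q where U: "zariski_closed (- U)" "q \<in> U" "\<forall>q\<in>U. P q"
    using assms unfolding generic_def by blast
  from U(1) obtain T where T: "\<forall>F\<in>T. \<exists>d. homogeneous d F" "- U = {q. \<forall>F\<in>T. vanishes_at F q}"
    unfolding zariski_closed_def by blast
  with U(2) obtain F where F: "F \<in> T" "\<not> vanishes_at F q" by blast
  with T obtain d where "homogeneous d F" by blast
  moreover have "F \<noteq> 0"
    using F by (auto simp: vanishes_at_def eval3_eq_ev)
  moreover have "P q'" if "\<not> vanishes_at F q'" for q'
    using that T U F by blast
  ultimately show ?thesis by blast
qed

text \<open>The plane is irreducible.\<close>

lemma generic_both_ex:
  assumes "generic P" "generic Q" shows "\<exists>q. P q \<and> Q q"
proof -
  obtain d F where F: "homogeneous d F" "F \<noteq> 0" "\<And>q. \<not> vanishes_at F q \<Longrightarrow> P q"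
    using generic_nonvanishing [OF assms(1)] by blast
  obtain e G where G: "homogeneous e G" "G \<noteq> 0" "\<And>q. \<not> vanishes_at G q \<Longrightarrow> Q q"
    using generic_nonvanishing [OF assms(2)] by blast
  \<comment> \<open>The factor \<open>varX\<close> keeps the point found away from the origin even
    if both forms are constant.\<close>
  have "varX * (F * G) \<noteq> 0" using F G vars_neq_0 by simp
  then obtain x y z where "ev (varX * (F * G)) x y z \<noteq> 0" by (rule poly3_nonzero_point)
  then have "x \<noteq> 0" "ev F x y z \<noteq> 0" "ev G x y z \<noteq> 0" by auto
  then show ?thesis
    using F G vanishes_at_pt [of d F x y z] vanishes_at_pt [of e G x y z]
    by (intro exI [of _ "pt x y z"]) simp
qed

section \<open>The dual points and the curve of degree \<open>m + 2\<close>\<close>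

text \<open>The numbers s for which the line x + s y = 0 lies in x^m = y^m: on it x^m = (-1)^m s^m
  y^m.\<close>

definition nroots :: "nat \<Rightarrow> complex set" where
  "nroots m = {s. s ^ m = (- 1) ^ m}"

text \<open>In each triple the leading nonzero coordinate is 1, so distinct triples are distinct
  points and \<open>card_Zpts\<close> counts points.\<close>

definition Zpts :: "nat \<Rightarrow> (complex \<times> complex \<times> complex) set" where
  "Zpts m = {(1, 0, 0), (0, 1, 0)} \<union> (\<lambda>s. (1, s, 0)) ` nroots m \<union>
     (\<lambda>s. (0, 1, s)) ` nroots m \<union> (\<lambda>s. (1, 0, s)) ` nroots m"

lemma card_nroots: "m > 0 \<Longrightarrow> card (nroots m) = m"
  unfolding nroots_def by (rule card_nth_roots) auto

lemma finite_nroots: "m > 0 \<Longrightarrow> finite (nroots m)"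
  using card_nroots [of m] card_ge_0_finite [of "nroots m"] by simp

lemma zero_notin_nroots: "m > 0 \<Longrightarrow> 0 \<notin> nroots m"
  by (simp add: nroots_def power_0_left)

lemma finite_Zpts: "m > 0 \<Longrightarrow> finite (Zpts m)"
  by (simp add: Zpts_def finite_nroots)

lemma card_Zpts:
  assumes m: "m > 0" shows "card (Zpts m) = 3 * m + 2"
proof -
  let ?A = "(\<lambda>s. (1, s, 0)) ` nroots m :: (complex \<times> complex \<times> complex) set"
  let ?B = "(\<lambda>s. (0, 1, s)) ` nroots m :: (complex \<times> complex \<times> complex) set"
  let ?C = "(\<lambda>s. (1, 0, s)) ` nroots m :: (complex \<times> complex \<times> complex) set"
  note fin = finite_nroots [OF m] and nz = zero_notin_nroots [OF m]
  have "card ?A = m" "card ?B = m" "card ?C = m"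
    by (subst card_image; simp add: inj_on_def card_nroots m)+
  moreover have "card ({(1, 0, 0), (0, 1, 0)} \<union> ?A) = card {(1, 0, 0), (0, 1, 0 :: complex) :: complex \<times> complex \<times> complex} + card ?A"
    by (rule card_Un_disjoint) (use fin nz in auto)
  moreover have "card ({(1, 0, 0), (0, 1, 0)} \<union> ?A \<union> ?B) = card ({(1, 0, 0), (0, 1, 0)} \<union> ?A) + card ?B"
    by (rule card_Un_disjoint) (use fin nz in auto)
  moreover have "card (Zpts m) = card ({(1, 0, 0), (0, 1, 0)} \<union> ?A \<union> ?B) + card ?C"
    unfolding Zpts_def
  proof (rule card_Un_disjoint)
    have "{(1, 0, 0), (0, 1, 0)} \<inter> ?C = {}" "?A \<inter> ?C = {}" "?B \<inter> ?C = {}"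
      using nz by (simp_all add: disjoint_iff image_iff)
    then show "({(1, 0, 0), (0, 1, 0)} \<union> ?A \<union> ?B) \<inter> ?C = {}"
      by (simp only: Int_Un_distrib2 Un_empty_left)
  qed (use fin in simp_all)
  ultimately show ?thesis by simp
qed

lemma Zpts_nonzero: "(x, y, z) \<in> Zpts m \<Longrightarrow> (x, y, z) \<noteq> (0, 0, 0)"
  by (auto simp: Zpts_def)

lemma Zpts_cases:
  assumes "(x, y, z) \<in> Zpts m"
  obtains "x = 1" "y = 0" "z = 0" | "x = 0" "y = 1" "z = 0" | "x = 1" "y \<in> nroots m" "z = 0"
    | "x = 0" "y = 1" "z \<in> nroots m" | "x = 1" "y = 0" "z \<in> nroots m"
  using assms by (auto simp: Zpts_def)

lemma Zpts_cross_neq_0: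
  assumes "(x, y, z) \<in> Zpts m" "(x', y', z') \<in> Zpts m" "(x, y, z) \<noteq> (x', y', z')"
  shows "(y * z' - z * y', z * x' - x * z', x * y' - y * x') \<noteq> (0, 0, 0)"
proof -
  have "x = 1 \<or> x = 0 \<and> y = 1" "x' = 1 \<or> x' = 0 \<and> y' = 1"
    using assms by (auto simp: Zpts_def)
  with assms(3) show ?thesis by auto
qed

lemma dual_points_fA2_eq:
  assumes m: "m > 0"
  shows "dual_points (arrangement (fA2 m)) = (\<lambda>(x, y, z). pt x y z) ` Zpts m"
proof (intro set_eqI iffI)
  fix p assume "p \<in> dual_points (arrangement (fA2 m))"
  moreover obtain a b c where p: "p = pt a b c" "(a, b, c) \<noteq> (0, 0, 0)" by (rule pt_cases)
  ultimately have d: "dual_fA2 m a b c" using dual_points_fA2 [OF m] by blast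
  have memI: "p \<in> (\<lambda>(x, y, z). pt x y z) ` Zpts m"
    if "(x, y, z) \<in> Zpts m" "a = k * x" "b = k * y" "c = k * z" for x y z k
  proof -
    have "pt x y z = p" using p pt_eq_iff [OF Zpts_nonzero [OF that(1)] p(2)] that by blast
    with that(1) show ?thesis by force
  qed
  have root: "v / u \<in> nroots m" if "v ^ m = (- u) ^ m" "u \<noteq> 0" for u v :: complex
    using that by (simp add: nroots_def power_divide power_minus [of u])
  from d consider "c = 0" "a = 0" | "c = 0" "b = 0" | "c = 0" "b ^ m = (- a) ^ m" "a \<noteq> 0"
    | "a = 0" "c ^ m = (- b) ^ m" | "b = 0" "c ^ m = (- a) ^ m"
    unfolding dual_fA2_def by metis
  then show "p \<in> (\<lambda>(x, y, z). pt x y z) ` Zpts m"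
  proof cases
    case 1 then show ?thesis by (intro memI [of 0 1 0 b]) (auto simp: Zpts_def)
  next
    case 2 then show ?thesis by (intro memI [of 1 0 0 a]) (auto simp: Zpts_def)
  next
    case 3 then show ?thesis using root [of b a] by (intro memI [of 1 "b / a" 0 a]) (auto simp: Zpts_def)
  next
    case 4
    then have "b \<noteq> 0" using p m by (auto simp: power_0_left)
    with 4 show ?thesis using root [of c b] by (intro memI [of 0 1 "c / b" b]) (auto simp: Zpts_def)
  next
    case 5
    then have "a \<noteq> 0" using p m by (auto simp: power_0_left)
    with 5 show ?thesis using root [of c a] by (intro memI [of 1 0 "c / a" a]) (auto simp: Zpts_def)
  qed
next
  fix p assume "p \<in> (\<lambda>(x, y, z). pt x y z) ` Zpts m"
  then obtain x y z where p: "p = pt x y z" "(x, y, z) \<in> Zpts m" by auto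
  from p(2) have "dual_fA2 m x y z"
    by (rule Zpts_cases) (auto simp: dual_fA2_def nroots_def)
  then show "p \<in> dual_points (arrangement (fA2 m))"
    using dual_points_fA2 [OF m Zpts_nonzero [OF p(2)]] p by simp
qed

lemma forms_through_fA2:
  assumes "m > 0"
  shows "F \<in> forms_through j (dual_points (arrangement (fA2 m))) \<longleftrightarrow>
    homogeneous j F \<and> (\<forall>(x, y, z)\<in>Zpts m. ev F x y z = 0)"
proof -
  have "vanishes_at F (pt x y z) \<longleftrightarrow> ev F x y z = 0" if "homogeneous j F" "(x, y, z) \<in> Zpts m" for x y z
    using vanishes_at_pt [OF that(1) Zpts_nonzero [OF that(2)]] .
  then show ?thesis
    unfolding forms_through_def dual_points_fA2_eq [OF assms] by auto
qed

section \<open>Calculus of multiplicities\<close>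

lemma deriv3_commute:
  "derivY (derivX F) = derivX (derivY F)" "derivZ (derivX F) = derivX (derivZ F)"
  "derivZ (derivY F) = derivY (derivZ F)"
  by (auto intro!: poly_eqI simp: derivX_def derivY_def derivZ_def coeff_map_poly coeff_pderiv of_nat_poly)

text \<open>\<open>vanishes_to_order\<close> takes z-derivatives innermost and x-derivatives
  outermost, so the induction has to move a new innermost derivative past the others.\<close>

lemma vord_if_vanishes_to_order:
  fixes v :: "complex^3"
  assumes "vanishes_to_order n F q" "v \<in> hcoords q"
  shows "vord n F (v $ 1) (v $ 2) (v $ 3)"
proof -
  have "vord n F x y z"
    if "\<And>i j k. i + j + k < n \<Longrightarrow> ev ((derivX ^^ i) ((derivY ^^ j) ((derivZ ^^ k) F))) x y z = 0" for x y z
    using that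
  proof (induction n arbitrary: F)
    case (Suc n)
    have Z: "(derivZ ^^ k) (derivX G) = derivX ((derivZ ^^ k) G)" "(derivZ ^^ k) (derivY G) = derivY ((derivZ ^^ k) G)" for k G
      by (induction k) (auto simp: deriv3_commute)
    have Y: "(derivY ^^ k) (derivX G) = derivX ((derivY ^^ k) G)" for k G
      by (induction k) (auto simp: deriv3_commute)
    have "vord n (derivX F) x y z"
    proof (rule Suc.IH)
      fix i j k assume "i + j + k < n"
      then show "ev ((derivX ^^ i) ((derivY ^^ j) ((derivZ ^^ k) (derivX F)))) x y z = 0"
        using Suc.prems [of "Suc i" j k] by (simp add: Y Z funpow_swap1)
    qed
    moreover have "vord n (derivY F) x y z"
    proof (rule Suc.IH)
      fix i j k assume "i + j + k < n"
      then show "ev ((derivX ^^ i) ((derivY ^^ j) ((derivZ ^^ k) (derivY F)))) x y z = 0"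
        using Suc.prems [of i "Suc j" k] by (simp add: Z funpow_swap1)
    qed
    moreover have "vord n (derivZ F) x y z"
    proof (rule Suc.IH)
      fix i j k assume "i + j + k < n"
      then show "ev ((derivX ^^ i) ((derivY ^^ j) ((derivZ ^^ k) (derivZ F)))) x y z = 0"
        using Suc.prems [of i j "Suc k"] by (simp add: funpow_swap1)
    qed
    ultimately show ?case using Suc.prems [of 0 0 0] by simp
  qed simp
  then show ?thesis
    using assms by (simp add: vanishes_to_order_def vanishes_at_def eval3_eq_ev)
qed

lemma vanishes_to_order_mult:
  "vanishes_to_order m F q \<Longrightarrow> vanishes_to_order n G q \<Longrightarrow> vanishes_to_order (m + n) (F * G) q"
  by (rule vanishes_to_orderI, rule vord_mult; rule vord_if_vanishes_to_order; assumption)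

lemma vanishes_to_order_add:
  "vanishes_to_order n F q \<Longrightarrow> vanishes_to_order n G q \<Longrightarrow> vanishes_to_order n (F + G) q"
  by (rule vanishes_to_orderI, rule vord_add; rule vord_if_vanishes_to_order; assumption)

lemma vanishes_to_order_0: "vanishes_to_order 0 F q"
  by (simp add: vanishes_to_order_def)

lemma vanishes_to_order_linform_power:
  assumes "u * a + v * b + w = 0"
  shows "vanishes_to_order n (linform u v w ^ n) (pt a b 1)"
proof (rule vanishes_to_orderI, rule vord_power)
  fix p :: "complex^3" assume "p \<in> hcoords (pt a b 1)"
  then obtain k where "p = vector [k * a, k * b, k * 1]" by (auto simp: hcoords_pt)
  then have "ev (linform u v w) (p $ 1) (p $ 2) (p $ 3) = k * (u * a + v * b + w)"
    by (simp add: algebra_simps)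
  with assms show "ev (linform u v w) (p $ 1) (p $ 2) (p $ 3) = 0" by simp
qed

text \<open>
  The lines through \<open>q = (a : b : 1)\<close> are parametrised by the points \<open>v = u \<times> q\<close> of the dual line
  of \<open>q\<close>; the curve consists of the points \<open>u\<close> orthogonal to the value at \<open>v\<close> of the derivation
  \<open>(x\<^sup>m\<^sup>+\<^sup>1, y\<^sup>m\<^sup>+\<^sup>1, z\<^sup>m\<^sup>+\<^sup>1)\<close>.
\<close>

definition curve :: "nat \<Rightarrow> complex \<Rightarrow> complex \<Rightarrow> poly3" where
  "curve m a b = varX * linform 0 1 (- b) ^ (m + 1) + varY * linform (- 1) 0 a ^ (m + 1) +
     varZ * linform b (- a) 0 ^ (m + 1)"

lemma ev_curve: "ev (curve m a b) x y z =
    x * (y - b * z) ^ (m + 1) + y * (a * z - x) ^ (m + 1) + z * (b * x - a * y) ^ (m + 1)"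
  by (simp add: curve_def)

lemma homogeneous_curve: "homogeneous (m + 2) (curve m a b)"
proof -
  have "homogeneous (Suc 0 + (m + 1)) (curve m a b)"
    unfolding curve_def
    by (intro homogeneous_add homogeneous_mult homogeneous_power1 homogeneous_linform homogeneous_var)
  then show ?thesis by simp
qed

lemma vanishes_to_order_curve: "vanishes_to_order (m + 1) (curve m a b) (pt a b 1)"
proof -
  have "vanishes_to_order (0 + (m + 1)) (curve m a b) (pt a b 1)"
    unfolding curve_def
    by (intro vanishes_to_order_add vanishes_to_order_mult vanishes_to_order_0
        vanishes_to_order_linform_power) simp_all
  then show ?thesis by simp
qed

lemma minus1_power_mult_self: "(- 1) ^ m * (- 1) ^ m = (1 :: complex)"
  using power_mult_distrib [of "- 1 :: complex" "- 1" m] by simp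

text \<open>An explicit form of the invariance of the dual lines under theta: in each family indexed
  by \<open>nroots m\<close> two terms remain, and they cancel by s^m = (-1)^m.\<close>

lemma curve_vanishes_on_Zpts:
  assumes "(x, y, z) \<in> Zpts m" shows "ev (curve m a b) x y z = 0"
proof -
  from assms show ?thesis
  proof (cases rule: Zpts_cases)
    case 3
    then show ?thesis by (simp add: ev_curve nroots_def)
  next
    case 4
    have "ev (curve m a b) 0 1 z = a * z * (a ^ m * z ^ m - (- a) ^ m)"
      by (simp add: ev_curve power_mult_distrib algebra_simps)
    also have "(- a) ^ m = (- 1) ^ m * a ^ m" by (rule power_minus)
    finally show ?thesis using 4 by (simp add: nroots_def)
  next
    case 5
    have "ev (curve m a b) 1 0 z = b * z * (b ^ m - (- (b * z)) ^ m)"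
      by (simp add: ev_curve algebra_simps)
    also have "(- (b * z)) ^ m = (- 1) ^ m * (b ^ m * z ^ m)"
      by (subst power_minus) (simp add: power_mult_distrib)
    also have "z ^ m = (- 1) ^ m" using 5 by (simp add: nroots_def)
    finally show ?thesis
      using 5 minus1_power_mult_self [of m] by (simp add: mult.left_commute [of _ "b ^ m"])
  qed (simp_all add: ev_curve)
qed

text \<open>
  The first conditions say that \<open>q\<close> is orthogonal to no \<open>v\<close> that is parallel to its value under the
  derivation, so that the curve contains no line through \<open>q\<close>; the last one says that no line
  through \<open>q\<close> contains two dual points.
\<close>

definition good :: "nat \<Rightarrow> complex \<Rightarrow> complex \<Rightarrow> bool" where
  "good m a b \<longleftrightarrow> a \<noteq> 0 \<and> b \<noteq> 0 \<and>
     (\<forall>\<zeta>. \<zeta> ^ m = 1 \<longrightarrow> a + \<zeta> \<noteq> 0 \<and> b + \<zeta> \<noteq> 0 \<and> \<zeta> * a + b \<noteq> 0 \<and>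
        (\<forall>\<omega>. \<omega> ^ m = 1 \<longrightarrow> \<omega> * a + b + \<zeta> \<noteq> 0)) \<and>
     (\<forall>x y z x' y' z'. (x, y, z) \<in> Zpts m \<and> (x', y', z') \<in> Zpts m \<and> (x, y, z) \<noteq> (x', y', z') \<longrightarrow>
        (y * z' - z * y') * a + (z * x' - x * z') * b + (x * y' - y * x') \<noteq> 0)"

lemma generic_good:
  assumes m: "m > 0" shows "generic (\<lambda>q. \<exists>a b. q = pt a b 1 \<and> good m a b)"
proof -
  let ?R = "{\<zeta> :: complex. \<zeta> ^ m = 1}"
  \<comment> \<open>The cross product gives the line through two dual points; q has to avoid all
    these lines.\<close>
  let ?cross = "\<lambda>((x, y, z), (x', y', z')). (y * z' - z * y', z * x' - x * z', x * y' - y * x' :: complex)"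
  define W where "W = {(1, 0, 0), (0, 1, 0)} \<union> (\<lambda>\<zeta>. (1, 0, \<zeta>)) ` ?R \<union> (\<lambda>\<zeta>. (0, 1, \<zeta>)) ` ?R \<union> (\<lambda>\<zeta>. (\<zeta>, 1, 0)) ` ?R
    \<union> (\<lambda>(\<omega>, \<zeta>). (\<omega>, 1, \<zeta>)) ` (?R \<times> ?R) \<union> ?cross ` {p \<in> Zpts m \<times> Zpts m. fst p \<noteq> snd p}"
  have "finite ?R" using finite_nth_roots [OF m] by simp
  then have "finite W" unfolding W_def using finite_Zpts [OF m] by simp
  moreover have "(0, 0, 0) \<notin> ?cross ` {p \<in> Zpts m \<times> Zpts m. fst p \<noteq> snd p}"
  proof
    assume "(0, 0, 0) \<in> ?cross ` {p \<in> Zpts m \<times> Zpts m. fst p \<noteq> snd p}"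
    then obtain x y z x' y' z' where "(x, y, z) \<in> Zpts m" "(x', y', z') \<in> Zpts m" "(x, y, z) \<noteq> (x', y', z')"
      "(y * z' - z * y', z * x' - x * z', x * y' - y * x') = (0, 0, 0)" by auto
    with Zpts_cross_neq_0 show False by blast
  qed
  then have "(0, 0, 0) \<notin> W" unfolding W_def by auto
  ultimately have "generic (\<lambda>q. \<exists>a b. q = pt a b 1 \<and> (\<forall>(u, v, w)\<in>W. u * a + v * b + w \<noteq> 0))"
    by (rule genericI_linear)
  then show ?thesis
  proof (rule generic_mono)
    fix q assume "\<exists>a b. q = pt a b 1 \<and> (\<forall>(u, v, w)\<in>W. u * a + v * b + w \<noteq> 0)"
    then obtain a b where q: "q = pt a b 1" and W: "\<And>u v w. (u, v, w) \<in> W \<Longrightarrow> u * a + v * b + w \<noteq> 0" by blast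
    have "(y * z' - z * y') * a + (z * x' - x * z') * b + (x * y' - y * x') \<noteq> 0"
      if "(x, y, z) \<in> Zpts m" "(x', y', z') \<in> Zpts m" "(x, y, z) \<noteq> (x', y', z')" for x y z x' y' z'
    proof (rule W)
      have "?cross ((x, y, z), (x', y', z')) \<in> W"
        unfolding W_def by (intro UnI2 imageI) (use that in simp)
      then show "(y * z' - z * y', z * x' - x * z', x * y' - y * x') \<in> W" by simp
    qed
    moreover have "a \<noteq> 0" "b \<noteq> 0" using W [of 1 0 0] W [of 0 1 0] by (simp_all add: W_def)
    moreover have "a + \<zeta> \<noteq> 0" "b + \<zeta> \<noteq> 0" "\<zeta> * a + b \<noteq> 0" if "\<zeta> ^ m = 1" for \<zeta>
      using W [of 1 0 \<zeta>] W [of 0 1 \<zeta>] W [of \<zeta> 1 0] that by (auto simp: W_def)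
    moreover have "\<omega> * a + b + \<zeta> \<noteq> 0" if "\<omega> ^ m = 1" "\<zeta> ^ m = 1" for \<omega> \<zeta>
    proof -
      have "(\<omega>, 1, \<zeta>) \<in> (\<lambda>(\<omega>, \<zeta>). (\<omega>, 1, \<zeta>)) ` (?R \<times> ?R)" using that by force
      then have "(\<omega>, 1, \<zeta>) \<in> W" unfolding W_def by blast
      from W [OF this] show ?thesis by simp
    qed
    ultimately show "\<exists>a b. q = pt a b 1 \<and> good m a b"
      using q unfolding good_def by blast
  qed
qed

text \<open>The coefficients of z^0 and z^1 once q is shifted to (0:0:1). The bases y, -x and b x -
  a y of the powers are the coordinates of u x q, which no longer involve z.\<close>

definition curve0 :: "nat \<Rightarrow> complex poly poly" where
  "curve0 m = [:[:0, 1:]:] * [:0, 1:] ^ (m + 1) + [:0, 1:] * (- [:[:0, 1:]:]) ^ (m + 1)"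

definition curve1 :: "nat \<Rightarrow> complex \<Rightarrow> complex \<Rightarrow> complex poly poly" where
  "curve1 m a b = [:[:a:]:] * [:0, 1:] ^ (m + 1) + [:[:b:]:] * (- [:[:0, 1:]:]) ^ (m + 1) +
     ([:[:b:]:] * [:[:0, 1:]:] - [:[:a:]:] * [:0, 1:]) ^ (m + 1)"

lemma poly_curve0: "poly (poly (curve0 m) [:y:]) x = x * y ^ (m + 1) + y * (- x) ^ (m + 1)"
  by (simp add: curve0_def right_diff_distrib)

lemma poly_curve1:
  "poly (poly (curve1 m a b) [:y:]) x = a * y ^ (m + 1) + b * (- x) ^ (m + 1) + (b * x - a * y) ^ (m + 1)"
  by (simp add: curve1_def algebra_simps)

lemma ev_linear: "ev [:A, B:] x y z = poly (poly A [:y:]) x + z * poly (poly B [:y:]) x"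
  by (simp add: ev_def)

lemma shift_curve: "shift a b (curve m a b) = [:curve0 m, curve1 m a b:]"
  by (rule poly3_eqI)
    (simp add: ev_linear poly_curve0 poly_curve1 ev_curve algebra_simps)

text \<open>The zeros of \<open>curve0\<close> are the directions x = 0, y = 0 and y^m = (-x)^m. In
  each of them the vanishing of \<open>curve1\<close> becomes a linear relation between a and b
  built from roots of unity, and \<open>good\<close> excludes these relations.\<close>

lemma curve_common_zero:
  assumes m: "m > 0" and good: "good m a b"
    and c0: "poly (poly (curve0 m) [:y:]) x = 0" and c1: "poly (poly (curve1 m a b) [:y:]) x = 0"
  shows "x = 0 \<and> y = 0"
proof (rule ccontr)
  note c0 = c0 [unfolded poly_curve0] and c1 = c1 [unfolded poly_curve1]
  assume xy: "\<not> (x = 0 \<and> y = 0)"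
  have ab: "a \<noteq> 0" "b \<noteq> 0" using good by (auto simp: good_def)
  note sq = minus1_power_mult_self [of m]
  have neg: "(- u) ^ m = (- 1) ^ m * u ^ m" for u :: complex by (rule power_minus)
  have "x * y * (y ^ m - (- x) ^ m) = 0"
    using c0 by (simp add: algebra_simps)
  then consider "x = 0" | "y = 0" | "y ^ m = (- x) ^ m" "x \<noteq> 0" by auto
  then show False
  proof cases
    case 1
    with xy have y: "y \<noteq> 0" by simp
    have "(- (a * y)) ^ m = (- a) ^ m * y ^ m"
      by (simp flip: power_mult_distrib)
    with c1 have "a * y ^ (m + 1) * (1 - (- a) ^ m) = 0"
      by (simp add: 1 algebra_simps)
    with ab y have "(- a) ^ m = 1" by simp
    with good have "a + - a \<noteq> 0" unfolding good_def by blast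
    then show False by simp
  next
    case 2
    with xy have x: "x \<noteq> 0" by simp
    from c1 have "b * x ^ (m + 1) * (b ^ m - (- 1) ^ m) = 0"
      by (simp add: 2 neg [of x] power_mult_distrib algebra_simps)
    with ab x have "b ^ m = (- 1) ^ m" by simp
    then have "(- b) ^ m = 1" by (simp only: neg [of b] sq)
    with good have "b + - b \<noteq> 0" unfolding good_def by blast
    then show False by simp
  next
    case 3
    define \<omega> where "\<omega> = - y / x"
    have y: "y = - \<omega> * x" using 3 by (simp add: \<omega>_def)
    have "\<omega> ^ m = (- 1) ^ m * y ^ m / x ^ m"
      unfolding \<omega>_def power_divide neg [of y] ..
    also have "y ^ m = (- 1) ^ m * x ^ m" using 3 neg [of x] by simp
    also have "(- 1) ^ m * ((- 1) ^ m * x ^ m) / x ^ m = 1"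
      using 3 sq by (simp flip: mult.assoc)
    finally have \<omega>: "\<omega> ^ m = 1" .
    \<comment> \<open>Since \<open>(- x) ^ m = y ^ m\<close>, the other two terms of
      \<open>curve1\<close> combine to \<open>- D * y ^ m\<close>, and its vanishing reads
      \<open>D * (D ^ m - y ^ m) = 0\<close>.\<close>
    define D where "D = b * x - a * y"
    have "D * (D ^ m - y ^ m) = a * y ^ (m + 1) - b * x * y ^ m + D ^ (m + 1)"
      by (simp add: D_def algebra_simps)
    also have "\<dots> = 0"
      using c1 by (simp add: mult.assoc flip: D_def 3(1))
    finally have "(b * x - a * y) * ((b * x - a * y) ^ m - y ^ m) = 0"
      unfolding D_def .
    moreover have "b * x - a * y = (\<omega> * a + b) * x" by (simp add: y algebra_simps)
    ultimately have "(\<omega> * a + b) * x = 0 \<or> ((\<omega> * a + b) * x) ^ m = y ^ m" by simp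
    moreover have "\<omega> * a + b \<noteq> 0" using good \<omega> unfolding good_def by blast
    ultimately have "(\<omega> * a + b) ^ m * x ^ m = y ^ m" using 3 by (simp add: power_mult_distrib)
    also have "y ^ m = (- 1) ^ m * x ^ m" using 3 neg [of x] by simp
    finally have "(\<omega> * a + b) ^ m = (- 1) ^ m" using 3 by simp
    then have "(- (\<omega> * a + b)) ^ m = 1" by (simp only: neg [of "\<omega> * a + b"] sq)
    with good \<omega> have "\<omega> * a + b + - (\<omega> * a + b) \<noteq> 0" unfolding good_def by blast
    then show False by simp
  qed
qed

section \<open>Uniqueness and irreducibility\<close>

lemma coprime_curve01:
  assumes "m > 0" "good m a b" shows "coprime (curve0 m) (curve1 m a b)"
proof (rule coprimeI)
  fix h assume h: "h dvd curve0 m" "h dvd curve1 m a b"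
  show "is_unit h"
  proof (rule is_unit_of_zeros)
    fix x y assume "poly (poly h [:y:]) x = 0"
    with h have "poly (poly (curve0 m) [:y:]) x = 0" "poly (poly (curve1 m a b) [:y:]) x = 0"
      by (auto elim!: dvdE)
    then show "x = 0 \<and> y = 0" by (rule curve_common_zero [OF assms])
  qed
qed

text \<open>At x = 1, y = 0 the polynomial \<open>curve0\<close> vanishes, hence
  \<open>curve1\<close> does not. If \<open>curve0\<close> were zero, coprimality would make
  \<open>curve1\<close> a unit, although it vanishes at the origin.\<close>

lemma curve01_neq_0:
  assumes "m > 0" "good m a b" shows "curve0 m \<noteq> 0" "curve1 m a b \<noteq> 0"
proof -
  have 0: "poly (poly (curve0 m) [:0:]) 1 = 0"
    unfolding poly_curve0 by simp
  have "poly (poly (curve1 m a b) [:0:]) 1 \<noteq> 0"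
  proof
    assume "poly (poly (curve1 m a b) [:0:]) 1 = 0"
    from curve_common_zero [OF assms 0 this] show False by simp
  qed
  then show "curve1 m a b \<noteq> 0" by auto
  show "curve0 m \<noteq> 0"
  proof
    assume "curve0 m = 0"
    then have "is_unit (curve1 m a b)"
      using coprime_curve01 [OF assms] by simp
    then obtain H where H: "1 = curve1 m a b * H" by (rule dvdE)
    have "poly (poly (curve1 m a b) [:0:]) 0 = 0" unfolding poly_curve1 by simp
    then have "poly (poly 1 [:0:]) (0::complex) = 0" unfolding H by simp
    then show False by simp
  qed
qed

lemma irreducible_curve:
  assumes "m > 0" "good m a b" shows "irreducible (curve m a b)"
  by (rule irreducible_shift_D [of a b], unfold shift_curve)
    (intro irreducible_linear_poly coprime_curve01 curve01_neq_0 assms)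

text \<open>Where G is nonzero, comparing degrees makes K constant along the punctured line to the
  origin. The restriction of K to this line is a polynomial, so K equals its value at the
  origin.\<close>

lemma homogeneous_cofactor_const:
  assumes G: "homogeneous d G" and KG: "homogeneous d (K * G)" and "G \<noteq> 0"
  shows "\<exists>c. K = [:[:[:c:]:]:]"
proof -
  have "ev K x y z = ev K 0 0 0" if nz: "ev G x y z \<noteq> 0" for x y z
  proof -
    obtain p where p: "\<And>t. poly p t = ev K (0 + t * x) (0 + t * y) (0 + t * z)"
      using ev_line [of K 0 x 0 y 0 z] by blast
    have "poly (p - [:ev K x y z:]) t = 0" if t: "t \<in> - {0}" for t
    proof -
      have "ev K (t * x) (t * y) (t * z) * (t ^ d * ev G x y z) = t ^ d * (ev K x y z * ev G x y z)"
        using ev_homogeneous [OF KG, of t x y z] ev_homogeneous [OF G, of t x y z] by simp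
      with nz t show ?thesis by (simp add: p)
    qed
    moreover have "infinite (- {0 :: complex})"
      using infinite_UNIV_complex by (simp add: Compl_eq_Diff_UNIV)
    ultimately have "p - [:ev K x y z:] = 0"
      by (rule poly_eq_0_of_infinite [rotated])
    then have "poly p 0 = ev K x y z" by simp
    then show ?thesis by (simp add: p)
  qed
  then have "(K - [:[:[:ev K 0 0 0:]:]:]) * G = 0"
    by (intro poly3_eqI) (simp del: mult_pCons_left, metis)
  with \<open>G \<noteq> 0\<close> have "K = [:[:[:ev K 0 0 0:]:]:]" by simp
  then show ?thesis ..
qed

lemma degree_poly_1_le:
  assumes "\<And>i j. coeff (coeff A j) i \<noteq> 0 \<Longrightarrow> i \<le> n"
  shows "degree (poly A [:1 :: complex:]) \<le> n"
proof (rule degree_le, intro allI impI)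
  fix i assume "i > n"
  have "poly A [:1:] = (\<Sum>j\<le>degree A. coeff A j)"
    unfolding poly_altdef by (simp flip: one_pCons)
  then have "coeff (poly A [:1:]) i = (\<Sum>j\<le>degree A. coeff (coeff A j) i)"
    by (simp add: coeff_sum)
  also have "\<dots> = 0"
    using assms \<open>i > n\<close> by (intro sum.neutral) (metis linorder_not_less)
  finally show "coeff (poly A [:1:]) i = 0" .
qed

text \<open>The factor y in the second equation compensates for \<open>B\<close> having degree d - 1
  and keeps the exponent d in both.\<close>

lemma dehomogenize_linear:
  assumes "homogeneous d [:A, B:]" "y \<noteq> 0"
  shows "poly (poly A [:y:]) x = y ^ d * poly (poly A [:1:]) (x / y)"
    "y * poly (poly B [:y:]) x = y ^ d * poly (poly B [:1:]) (x / y)"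
proof -
  have *: "poly (poly A [:y:]) x + y * z * poly (poly B [:y:]) x
      = y ^ d * (poly (poly A [:1:]) (x / y) + z * poly (poly B [:1:]) (x / y))" for z
    using ev_homogeneous [OF assms(1), of y "x / y" 1 z] assms(2) by (simp only: ev_linear) (simp add: algebra_simps)
  from * [of 0] show "poly (poly A [:y:]) x = y ^ d * poly (poly A [:1:]) (x / y)" by simp
  with * [of 1] show "y * poly (poly B [:y:]) x = y ^ d * poly (poly B [:1:]) (x / y)"
    by (simp add: algebra_simps)
qed

text \<open>
  On every line through \<open>q\<close> two forms of degree \<open>m + 2\<close> and multiplicity \<open>m + 1\<close> at \<open>q\<close> have one
  further point each; these agree on the lines through the points of \<open>Z\<close>, which are too many.
\<close>

lemma multiple_of_curve:
  assumes m: "m \<ge> 3" and good: "good m a b"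
    and F: "F \<in> forms_through_mult (m + 2) (dual_points (arrangement (fA2 m))) (m + 1) (pt a b 1)"
  shows "\<exists>c. F = smultC c (curve m a b)"
proof -
  have m0: "m > 0" using m by simp
  let ?C0 = "curve0 m" and ?C1 = "curve1 m a b"
  have hF: "homogeneous (m + 2) F" and FZ: "\<And>x y z. (x, y, z) \<in> Zpts m \<Longrightarrow> ev F x y z = 0"
    and vF: "vanishes_to_order (m + 2 - 1) F (pt a b 1)"
    using F forms_through_fA2 [OF m0] by (auto simp: forms_through_mult_def)
  obtain A B where AB: "shift a b F = [:A, B:]"
    and A: "\<And>i j. coeff (coeff A j) i \<noteq> 0 \<Longrightarrow> i + j = m + 2"
    and B: "\<And>i j. coeff (coeff B j) i \<noteq> 0 \<Longrightarrow> i + j + 1 = m + 2"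
    using shift_normal_form [OF hF vF] by metis
  have vC: "vanishes_to_order (m + 2 - 1) (curve m a b) (pt a b 1)"
    using vanishes_to_order_curve by simp
  obtain A' B' where AB': "shift a b (curve m a b) = [:A', B':]"
    and A': "\<And>i j. coeff (coeff A' j) i \<noteq> 0 \<Longrightarrow> i + j = m + 2"
    and B': "\<And>i j. coeff (coeff B' j) i \<noteq> 0 \<Longrightarrow> i + j + 1 = m + 2"
    using shift_normal_form [OF homogeneous_curve vC] by metis
  have C0: "coeff (coeff ?C0 j) i \<noteq> 0 \<Longrightarrow> i + j = m + 2"
    and C1: "coeff (coeff ?C1 j) i \<noteq> 0 \<Longrightarrow> i + j + 1 = m + 2" for i j
    using AB' A' B' by (auto simp: shift_curve)
  have hAB: "homogeneous (m + 2) [:A, B:]"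
    using homogeneous_shift [OF hF] AB by metis
  have hC: "homogeneous (m + 2) [:?C0, ?C1:]"
    using homogeneous_shift [OF homogeneous_curve] shift_curve by metis
  \<comment> \<open>The determinant of the two linear equations in z: it vanishes in each direction
    (x : y) in which they have a common solution.\<close>
  define D where "D = A * ?C1 - ?C0 * B"
  have D1: "poly D [:1:] = 0"
  proof (rule ccontr)
    assume nz: "poly D [:1:] \<noteq> 0"
    have "degree (poly A [:1:] * poly ?C1 [:1:]) \<le> (m + 2) + (m + 1)"
      using A C1 by (intro order_trans [OF degree_mult_le] add_mono degree_poly_1_le) fastforce+
    moreover have "degree (poly ?C0 [:1:] * poly B [:1:]) \<le> (m + 2) + (m + 1)"
      using C0 B by (intro order_trans [OF degree_mult_le] add_mono degree_poly_1_le) fastforce+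
    ultimately have deg: "degree (poly D [:1:]) \<le> 2 * m + 3"
      unfolding D_def poly_diff poly_mult by (intro degree_diff_le) simp_all
    \<comment> \<open>\<open>t\<close> is the quotient of the shifted coordinates, the direction
      seen from q in the chart y = 1. The point (1, 0, 0) lies at infinity there and is left
      out.\<close>
    define Z' where "Z' = Zpts m - {(1, 0, 0)}"
    define t where "t = (\<lambda>(x, y, z). (x - a * z) / (y - b * z))"
    have cross: "(y * z' - z * y') * a + (z * x' - x * z') * b + (x * y' - y * x') \<noteq> 0"
      if "(x, y, z) \<in> Zpts m" "(x', y', z') \<in> Zpts m" "(x, y, z) \<noteq> (x', y', z')" for x y z x' y' z'
      using good that unfolding good_def by blast
    \<comment> \<open>Up to sign, this denominator is the \<open>cross\<close> expression for the
      point and the omitted (1, 0, 0).\<close>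
    have den: "y - b * z \<noteq> 0" if "(x, y, z) \<in> Z'" for x y z
      using cross [of x y z 1 0 0] that by (auto simp: Z'_def Zpts_def algebra_simps)
    have inj: "inj_on t Z'"
    proof (rule inj_onI)
      fix p q assume pq: "p \<in> Z'" "q \<in> Z'" "t p = t q"
      obtain x y z where p: "p = (x, y, z)" by (rule prod_cases3)
      obtain x' y' z' where q: "q = (x', y', z')" by (rule prod_cases3)
      have "y - b * z \<noteq> 0" "y' - b * z' \<noteq> 0" using den pq p q by blast+
      with pq(3) have "(x - a * z) * (y' - b * z') = (x' - a * z') * (y - b * z)"
        by (simp add: t_def p q frac_eq_eq)
      then have "(y * z' - z * y') * a + (z * x' - x * z') * b + (x * y' - y * x') = 0"
        by (simp add: algebra_simps)
      with cross [of x y z x' y' z'] pq show "p = q"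
        by (auto simp: Z'_def p q)
    qed
    have root: "poly (poly D [:1:]) (t p) = 0" if "p \<in> Z'" for p
    proof -
      obtain x y z where p: "p = (x, y, z)" by (metis prod_cases3)
      with that have Z: "(x, y, z) \<in> Zpts m" and y: "y - b * z \<noteq> 0" using den by (auto simp: Z'_def)
      define k where "k = 1 / (y - b * z)"
      have on: "poly (poly A'' [:1:]) (t p) + k * z * poly (poly B'' [:1:]) (t p) = 0"
        if "homogeneous (m + 2) G" "ev G x y z = 0" "shift a b G = [:A'', B'':]" for G A'' B''
      proof -
        have "ev [:A'', B'':] (x - a * z) (y - b * z) z = 0"
          using that by (simp flip: that(3))
        moreover have "homogeneous (m + 2) [:A'', B'':]"
          using homogeneous_shift [OF that(1)] that(3) by metis
        ultimately have "ev [:A'', B'':] (k * (x - a * z)) (k * (y - b * z)) (k * z) = 0"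
          by (simp add: ev_homogeneous)
        then show ?thesis
          using y by (simp add: ev_linear k_def t_def p)
      qed
      from on [OF hF FZ [OF Z] AB] on [OF homogeneous_curve curve_vanishes_on_Zpts [OF Z] shift_curve]
      have "poly (poly A [:1:]) (t p) = - (k * z * poly (poly B [:1:]) (t p))"
        "poly (poly ?C0 [:1:]) (t p) = - (k * z * poly (poly ?C1 [:1:]) (t p))"
        by (simp_all add: add_eq_0_iff2)
      then show ?thesis by (simp add: D_def)
    qed
    have "card Z' = 3 * m + 1"
    proof -
      have "(1, 0, 0) \<in> Zpts m" by (simp add: Zpts_def)
      then show ?thesis using card_Zpts [OF m0] by (simp add: Z'_def)
    qed
    then have "3 * m + 1 = card (t ` Z')" using card_image [OF inj] by simp
    also have "\<dots> \<le> card {x. poly (poly D [:1:]) x = 0}"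
      using root by (intro card_mono poly_roots_finite nz) auto
    also have "\<dots> \<le> 2 * m + 3"
      using card_poly_roots_bound [OF nz] deg by simp
    finally show False using m by simp
  qed
  \<comment> \<open>The extra factor y matches the form of \<open>dehomogenize_linear\<close> and is
    cancelled afterwards.\<close>
  have "[:0, 1:] * D = 0"
  proof (rule poly2_eqI)
    fix x y
    show "poly (poly ([:0, 1:] * D) [:y:]) x = poly (poly 0 [:y:]) x"
    proof (cases "y = 0")
      case False
      have "y * poly (poly D [:y:]) x = poly (poly A [:y:]) x * (y * poly (poly ?C1 [:y:]) x)
          - poly (poly ?C0 [:y:]) x * (y * poly (poly B [:y:]) x)"
        by (simp add: D_def algebra_simps)
      also have "\<dots> = y ^ (m + 2) * y ^ (m + 2) * poly (poly D [:1:]) (x / y)"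
        unfolding dehomogenize_linear [OF hAB False] dehomogenize_linear [OF hC False] D_def
        by (simp add: algebra_simps)
      finally show ?thesis by (simp add: D1)
    qed simp
  qed
  then have D: "A * ?C1 = ?C0 * B" by (simp add: D_def)
  \<comment> \<open>By coprimality the two pairs of coefficients differ by a polynomial factor
    \<open>K\<close>, which is constant because both forms have degree m + 2.\<close>
  then have "?C0 dvd A * ?C1" by simp
  then have "?C0 dvd A"
    using coprime_curve01 [OF m0 good] by (simp add: coprime_dvd_mult_left_iff)
  then obtain K where K: "A = ?C0 * K" ..
  with D curve01_neq_0 [OF m0 good] have B: "B = K * ?C1" by (simp add: mult.assoc)
  have "shift a b F = [:K:] * shift a b (curve m a b)"
    by (simp add: AB shift_curve K B mult.commute)
  moreover from this obtain c where "[:K:] = [:[:[:c:]:]:]"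
    using homogeneous_cofactor_const [of "m + 2" "shift a b (curve m a b)" "[:K:]"]
      homogeneous_shift [OF hF] homogeneous_shift [OF homogeneous_curve] curve01_neq_0 [OF m0 good]
    by (metis shift_curve pCons_eq_0_iff)
  ultimately have "shift a b F = shift a b (smultC c (curve m a b))"
    by (intro poly3_eqI) (simp del: mult_pCons_left)
  then show ?thesis unfolding shift_inject ..
qed

lemma irreducible_of_minimal_degree:
  assumes m: "m \<ge> 3" and good: "good m a b"
    and F: "F \<in> forms_through_mult (m + 2) (dual_points (arrangement (fA2 m))) (m + 1) (pt a b 1)"
    and "F \<noteq> 0"
  shows "irreducible F"
proof -
  obtain c where c: "F = smultC c (curve m a b)"
    using multiple_of_curve [OF assms(1-3)] by blast
  with \<open>F \<noteq> 0\<close> have "c \<noteq> 0" by (auto simp: smultC_def)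
  then have "is_unit [:[:[:c:]:]:]"
    by (simp add: is_unit_const_poly_iff dvd_field_iff)
  moreover have "F = [:[:[:c:]:]:] * curve m a b" by (simp add: c smultC_def)
  ultimately show ?thesis
    using irreducible_curve [OF _ good] m by (simp add: irreducible_mult_unit_left del: mult_pCons_left)
qed

lemma homogeneous_not_unit:
  assumes "homogeneous d F" "d > 0" shows "\<not> is_unit F"
proof
  assume "is_unit F"
  then obtain G where "1 = F * G" by (rule dvdE)
  then have "ev F 0 0 0 * ev G 0 0 0 = 1" by (metis ev_simps(2,6))
  moreover have "ev F 0 0 0 = 0"
    using ev_homogeneous [OF assms(1), of 0 0 0 0] assms(2) by (simp add: power_0_left)
  ultimately show False by simp
qed

text \<open>A nonzero form of such degree, times a power of a line through q, would be a reducible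
  form of degree m + 2 with multiplicity m + 1, against
  \<open>irreducible_of_minimal_degree\<close>.\<close>

lemma forms_through_mult_low_degree:
  assumes m: "m \<ge> 3" and good: "good m a b" and j: "2 \<le> j" "j \<le> m + 1"
  shows "forms_through_mult j (dual_points (arrangement (fA2 m))) (j - 1) (pt a b 1) \<subseteq> {0}"
proof
  fix F assume F: "F \<in> forms_through_mult j (dual_points (arrangement (fA2 m))) (j - 1) (pt a b 1)"
  have m0: "m > 0" using m by simp
  have hF: "homogeneous j F" and FZ: "\<And>x y z. (x, y, z) \<in> Zpts m \<Longrightarrow> ev F x y z = 0"
    and vF: "vanishes_to_order (j - 1) F (pt a b 1)"
    using F forms_through_fA2 [OF m0] by (auto simp: forms_through_mult_def)
  define L where "L = linform 1 0 (- a) ^ (m + 2 - j)"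
  have hL: "homogeneous (m + 2 - j) L"
    unfolding L_def by (intro homogeneous_power1 homogeneous_linform)
  have "L \<noteq> 0" unfolding L_def using linform_neq_0 [of 1 0 "- a"] by simp
  have "homogeneous (j + (m + 2 - j)) (F * L)" by (intro homogeneous_mult hF hL)
  then have "homogeneous (m + 2) (F * L)" using j by simp
  moreover have "vanishes_to_order (j - 1 + (m + 2 - j)) (F * L) (pt a b 1)"
    unfolding L_def by (intro vanishes_to_order_mult vF vanishes_to_order_linform_power) simp
  then have "vanishes_to_order (m + 1) (F * L) (pt a b 1)" using j by simp
  ultimately have FL: "F * L \<in> forms_through_mult (m + 2) (dual_points (arrangement (fA2 m))) (m + 1) (pt a b 1)"
    unfolding forms_through_mult_def forms_through_fA2 [OF m0] mem_Collect_eq using FZ by auto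
  have "F = 0"
  proof (rule ccontr)
    assume "F \<noteq> 0"
    with \<open>L \<noteq> 0\<close> have "irreducible (F * L)"
      by (intro irreducible_of_minimal_degree [OF m good FL]) simp
    then have "is_unit F \<or> is_unit L" by (rule irreducibleD) simp
    then show False
      using homogeneous_not_unit [OF hF] homogeneous_not_unit [OF hL] j by simp
  qed
  then show "F \<in> {0}" by simp
qed

section \<open>Dimension counts\<close>

text \<open>The finite spanning set M makes the bases of V finite; an infinite basis would have
  \<open>card\<close> 0.\<close>

lemma (in vector_space) card_le_dim:
  assumes "independent B" "B \<subseteq> V" "V \<subseteq> span M" "finite M"
  shows "card B \<le> dim V"
proof -
  obtain B' where B': "B \<subseteq> B'" "B' \<subseteq> V" "independent B'" "V \<subseteq> span B'"
    using maximal_independent_subset_extend [OF assms(2,1)] by blast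
  have "finite B'"
    using independent_span_bound [OF assms(4) B'(3)] B'(2) assms(3) by blast
  then have "card B \<le> card B'" using B'(1) by (rule card_mono)
  also have "card B' = dim V" by (rule basis_card_eq_dim [OF B'(2,4,3)])
  finally show ?thesis .
qed

text \<open>The subspace \<open>K u\<close> contains V and all the other \<open>S u'\<close> but not
  \<open>S u\<close>, so adjoining the \<open>S u\<close> to a basis of V keeps it independent. With
  point conditions as \<open>K\<close>, separated points impose independent conditions.\<close>

lemma (in vector_space) dim_plus_card_le:
  assumes N: "finite N" and M: "finite M" "V \<subseteq> span M" "S ` N \<subseteq> span M"
    and K: "\<And>u. u \<in> N \<Longrightarrow> subspace (K u)" "\<And>u. u \<in> N \<Longrightarrow> V \<subseteq> K u" "\<And>u. u \<in> N \<Longrightarrow> S u \<notin> K u"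
      "\<And>u u'. u \<in> N \<Longrightarrow> u' \<in> N \<Longrightarrow> u \<noteq> u' \<Longrightarrow> S u' \<in> K u"
  shows "dim V + card N \<le> card M"
proof -
  obtain B where B: "B \<subseteq> V" "independent B" "V \<subseteq> span B" "card B = dim V"
    by (rule basis_exists)
  have "finite B"
    using independent_span_bound [OF M(1) B(2)] B(1) M(2) by blast
  have "independent (B \<union> S ` N') \<and> card (B \<union> S ` N') = card B + card N'" if "N' \<subseteq> N" for N'
    using finite_subset [OF that N] that
  proof (induction N' rule: finite_induct)
    case empty
    then show ?case using B by simp
  next
    case (insert u N')
    have "B \<union> S ` N' \<subseteq> K u"
      using B(1) K(2) [of u] K(4) [of u] insert by auto
    then have "span (B \<union> S ` N') \<subseteq> K u"
      using K(1) [of u] insert by (intro span_minimal) auto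
    then have "S u \<notin> span (B \<union> S ` N')"
      using K(3) [of u] insert by blast
    moreover from this have "S u \<notin> B \<union> S ` N'"
      by (metis span_base)
    moreover have "B \<union> S ` insert u N' = insert (S u) (B \<union> S ` N')" by simp
    moreover have "independent (B \<union> S ` N')" "card (B \<union> S ` N') = card B + card N'"
      using insert by auto
    moreover have "finite (B \<union> S ` N')" using insert \<open>finite B\<close> by simp
    ultimately show ?case
      using insert(1,2) by (simp only: independent_insert card_insert_disjoint) simp
  qed
  from this [of N] have ind: "independent (B \<union> S ` N)" and card: "card (B \<union> S ` N) = card B + card N"
    by auto
  have "B \<union> S ` N \<subseteq> span M" using B M by blast
  from independent_span_bound [OF M(1) ind this] card B(4) show ?thesis by simp
qed

lemma (in vector_space) dim_subset_0:
  assumes "V \<subseteq> {0}" shows "dim V = 0"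
proof -
  obtain B where B: "B \<subseteq> V" "independent B" "card B = dim V"
    by (rule basis_exists)
  then have "0 \<notin> B" using dependent_zero by blast
  with B(1) assms have "B = {}" by blast
  with B(3) show ?thesis by simp
qed

lemma card_triangle: "card (SIGMA i:{..d}. {..d - i}) = (d + 2) choose 2"
proof -
  have "(\<Sum>i\<le>d. Suc (d - i)) = (d + 2) choose 2"
    by (induction d) (simp_all add: sum.atMost_Suc_shift numeral_2_eq_2 del: sum.atMost_Suc)
  then show ?thesis by simp
qed

interpretation forms: vector_space smultC by (rule vector_space_smultC)

definition monomials :: "nat \<Rightarrow> poly3 set" where
  "monomials d = (\<lambda>(i, j). monomial3 i j (d - i - j)) ` (SIGMA i:{..d}. {..d - i})"

lemma finite_monomials: "finite (monomials d)"
  by (simp add: monomials_def)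

lemma card_monomials_le: "card (monomials d) \<le> (d + 2) choose 2"
  unfolding monomials_def card_triangle [symmetric] by (rule card_image_le) simp

lemma homogeneous_in_span_monomials:
  assumes "homogeneous d F" shows "F \<in> forms.span (monomials d)"
proof -
  have "smultC c (monomial3 i j (d - i - j)) \<in> forms.span (monomials d)" if "i \<le> d" "j \<le> d - i" for c i j
  proof (intro forms.span_scale forms.span_base)
    show "monomial3 i j (d - i - j) \<in> monomials d"
      unfolding monomials_def using that by (intro image_eqI [of _ _ "(i, j)"]) auto
  qed
  then show ?thesis
    by (subst homogeneous_sum_mono [OF assms], intro forms.span_sum) auto
qed

text \<open>Separating forms exist already in degree m + 1; a coordinate with value 1 at the point
  raises the degree to j.\<close>

lemma Zpts_separated:
  assumes m: "m > 0" and j: "m + 1 \<le> j" and p: "(x, y, z) \<in> Zpts m"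
  shows "\<exists>G. homogeneous j G \<and> ev G x y z \<noteq> 0 \<and>
    (\<forall>x' y' z'. (x', y', z') \<in> Zpts m \<and> (x', y', z') \<noteq> (x, y, z) \<longrightarrow> ev G x' y' z' = 0)"
proof -
  note sq = minus1_power_mult_self [of m]
  let ?e = "smultC ((- 1) ^ m)"
  have nz: "s \<noteq> 0" if "s \<in> nroots m" for s using that zero_notin_nroots [OF m] by blast
  have root: "s ^ m = (- 1) ^ m" if "s \<in> nroots m" for s using that by (simp add: nroots_def)
  \<comment> \<open>The product vanishes wherever V or W does and at the points with (V, W) = (1, r)
    for the roots r other than s. Its degree is 2 + (m - 1).\<close>
  define Q where "Q = (\<lambda>V W s. V * W * (\<Prod>r\<in>nroots m - {s}. W - smultC r V))"
  have Q: "homogeneous (m + 1) (Q V W s)"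
    if "homogeneous (Suc 0) V" "homogeneous (Suc 0) W" "s \<in> nroots m" for V W s
  proof -
    have "homogeneous (Suc 0 + Suc 0 + card (nroots m - {s})) (Q V W s)"
      unfolding Q_def using finite_nroots [OF m] that
      by (intro homogeneous_mult homogeneous_prod homogeneous_diff homogeneous_smultC) auto
    then show ?thesis using card_nroots [OF m] that(3) m by simp
  qed
  have Q_nz: "ev (Q V W s) x y z \<noteq> 0" if "ev V x y z = 1" "ev W x y z = s" "s \<in> nroots m" for V W s x y z
    unfolding Q_def using that finite_nroots [OF m] nz by auto
  have Q_0: "ev (Q V W s) x y z = 0"
    if "ev V x y z = 0 \<or> ev W x y z = 0 \<or> ev V x y z = 1 \<and> ev W x y z \<in> nroots m \<and> ev W x y z \<noteq> s" for V W s x y z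
    unfolding Q_def using that finite_nroots [OF m] by auto
  have "\<exists>G. homogeneous (m + 1) G \<and> ev G x y z \<noteq> 0 \<and>
    (\<forall>x' y' z'. (x', y', z') \<in> Zpts m \<and> (x', y', z') \<noteq> (x, y, z) \<longrightarrow> ev G x' y' z' = 0)"
    using p
  proof (cases rule: Zpts_cases)
    case 1
    \<comment> \<open>The second factor is 1 at (1, 0, 0) and vanishes on both root families with x
      = 1, because s^m = (-1)^m; the factor x handles the points with x = 0.\<close>
    have "homogeneous (Suc 0 + m) (varX * (varX ^ m - ?e (varY ^ m) - ?e (varZ ^ m)))"
      by (intro homogeneous_mult homogeneous_diff homogeneous_smultC homogeneous_power1 homogeneous_var)
    then show ?thesis
      using 1 m sq by (intro exI [of _ "varX * (varX ^ m - ?e (varY ^ m) - ?e (varZ ^ m))"])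
        (auto simp: Zpts_def root power_0_left)
  next
    case 2
    have "homogeneous (Suc 0 + m) (varY * (varY ^ m - ?e (varX ^ m) - ?e (varZ ^ m)))"
      by (intro homogeneous_mult homogeneous_diff homogeneous_smultC homogeneous_power1 homogeneous_var)
    then show ?thesis
      using 2 m sq by (intro exI [of _ "varY * (varY ^ m - ?e (varX ^ m) - ?e (varZ ^ m))"])
        (auto simp: Zpts_def root power_0_left)
  next
    case 3
    then show ?thesis
      by (intro exI [of _ "Q varX varY y"] conjI Q Q_nz homogeneous_var) (auto simp: Zpts_def intro!: Q_0)
  next
    case 4
    then show ?thesis
      by (intro exI [of _ "Q varY varZ z"] conjI Q Q_nz homogeneous_var) (auto simp: Zpts_def intro!: Q_0)
  next
    case 5
    then show ?thesis
      by (intro exI [of _ "Q varX varZ z"] conjI Q Q_nz homogeneous_var) (auto simp: Zpts_def intro!: Q_0)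
  qed
  then obtain G where G: "homogeneous (m + 1) G" "ev G x y z \<noteq> 0"
    "\<And>x' y' z'. (x', y', z') \<in> Zpts m \<Longrightarrow> (x', y', z') \<noteq> (x, y, z) \<Longrightarrow> ev G x' y' z' = 0" by blast
  define L where "L = (if x = 1 then varX else varY)"
  have L: "homogeneous (Suc 0) L" by (simp add: L_def homogeneous_var)
  have "ev L x y z = 1" using p by (auto simp: L_def Zpts_def)
  moreover have "homogeneous (m + 1 + (j - (m + 1))) (G * L ^ (j - (m + 1)))"
    by (intro homogeneous_mult G homogeneous_power1 L)
  ultimately show ?thesis
    using G j by (intro exI [of _ "G * L ^ (j - (m + 1))"]) auto
qed

lemma dim_forms_through_le:
  assumes m: "m > 0" and j: "m + 1 \<le> j"
  shows "dimC (forms_through j (dual_points (arrangement (fA2 m)))) + (3 * m + 2) \<le> (j + 2) choose 2"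
proof -
  let ?V = "forms_through j (dual_points (arrangement (fA2 m)))"
  define e where "e = (\<lambda>F (x, y, z). ev F x y z)"
  have "\<forall>p\<in>Zpts m. \<exists>G. homogeneous j G \<and> e G p \<noteq> 0 \<and> (\<forall>p'\<in>Zpts m. p' \<noteq> p \<longrightarrow> e G p' = 0)"
    using Zpts_separated [OF m j] by (fastforce simp: e_def)
  from bchoice [OF this] obtain S where "\<forall>p\<in>Zpts m. homogeneous j (S p) \<and> e (S p) p \<noteq> 0 \<and>
      (\<forall>p'\<in>Zpts m. p' \<noteq> p \<longrightarrow> e (S p) p' = 0)" by blast
  then have S: "\<And>p. p \<in> Zpts m \<Longrightarrow> homogeneous j (S p)" "\<And>p. p \<in> Zpts m \<Longrightarrow> e (S p) p \<noteq> 0"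
    "\<And>p p'. p \<in> Zpts m \<Longrightarrow> p' \<in> Zpts m \<Longrightarrow> p' \<noteq> p \<Longrightarrow> e (S p) p' = 0"
    by simp_all
  have "forms.dim ?V + card (Zpts m) \<le> card (monomials j)"
  proof (rule forms.dim_plus_card_le [where S = S and K = "\<lambda>p. {F. e F p = 0}"])
    show "?V \<subseteq> forms.span (monomials j)" "S ` Zpts m \<subseteq> forms.span (monomials j)"
      using homogeneous_in_span_monomials S(1) by (auto simp: forms_through_def)
    fix p assume p: "p \<in> Zpts m"
    show "forms.subspace {F. e F p = 0}"
      by (rule forms.subspaceI) (auto simp: e_def case_prod_beta)
    show "?V \<subseteq> {F. e F p = 0}"
      using p forms_through_fA2 [OF m] by (auto simp: e_def)
  qed (use S finite_Zpts [OF m] finite_monomials in auto)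
  with card_monomials_le [of j] show ?thesis
    by (simp add: dimC_def card_Zpts [OF m])
qed

text \<open>The curve times the monomials of degree k = j - m - 2 in two lines through q gives k + 1
  independent forms.\<close>

lemma dim_forms_through_mult_ge:
  assumes m: "m > 0" and good: "good m a b" and j: "m + 2 \<le> j"
  shows "j - m - 1 \<le> dimC (forms_through_mult j (dual_points (arrangement (fA2 m))) (j - 1) (pt a b 1))"
proof -
  let ?V = "forms_through_mult j (dual_points (arrangement (fA2 m))) (j - 1) (pt a b 1)"
  define k where "k = j - (m + 2)"
  define g where "g = (\<lambda>i. curve m a b * (linform 1 0 (- a) ^ i * linform 0 1 (- b) ^ (k - i)))"
  have nz: "curve m a b \<noteq> 0" using irreducible_curve [OF m good] by auto
  have gV: "g i \<in> ?V" if "i \<le> k" for i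
  proof -
    have "homogeneous (m + 2 + (i + (k - i))) (g i)"
      unfolding g_def by (intro homogeneous_mult homogeneous_curve homogeneous_power1 homogeneous_linform)
    moreover have deg: "m + 2 + (i + (k - i)) = j" "m + 1 + (i + (k - i)) = j - 1"
      using that j unfolding k_def by linarith+
    ultimately have "homogeneous j (g i)" by (simp only:)
    moreover have "vanishes_to_order (m + 1 + (i + (k - i))) (g i) (pt a b 1)"
      unfolding g_def
      by (intro vanishes_to_order_mult vanishes_to_order_curve vanishes_to_order_linform_power) simp_all
    then have "vanishes_to_order (j - 1) (g i) (pt a b 1)" by (simp only: deg)
    ultimately show ?thesis
      unfolding forms_through_mult_def forms_through_fA2 [OF m] mem_Collect_eq
      using curve_vanishes_on_Zpts by (auto simp: g_def)
  qed
  have lin: "c i = 0" if "(\<Sum>i\<le>k. smultC (c i) (g i)) = 0" "i \<le> k" for c i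
  proof -
    have "curve m a b * (\<Sum>i\<le>k. smultC (c i) (linform 1 0 (- a) ^ i * linform 0 1 (- b) ^ (k - i))) = 0"
      using that(1) by (simp add: g_def sum_distrib_left smultC_def)
    with nz have "(\<Sum>i\<le>k. smultC (c i) (linform 1 0 (- a) ^ i * linform 0 1 (- b) ^ (k - i))) = 0"
      by simp
    \<comment> \<open>At (t + a, 1 + b, 1) the two lines take the values t and 1, which turns the
      relation into a polynomial in t with coefficients \<open>c i\<close>.\<close>
    then have "ev (\<Sum>i\<le>k. smultC (c i) (linform 1 0 (- a) ^ i * linform 0 1 (- b) ^ (k - i))) (t + a) (1 + b) 1 = 0" for t
      by simp
    then have "poly (\<Sum>i\<le>k. monom (c i) i) t = 0" for t
      by (simp add: poly_sum poly_monom)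
    then have "(\<Sum>i\<le>k. monom (c i) i) = 0"
      using poly_all_0_iff_0 by blast
    then have "coeff (\<Sum>i\<le>k. monom (c i) i) i = 0" by simp
    with that(2) show ?thesis by (simp add: coeff_sum)
  qed
  have inj: "inj_on g {..k}"
  proof (rule inj_onI, rule ccontr)
    fix i i' assume i: "i \<in> {..k}" "i' \<in> {..k}" "g i = g i'" "i \<noteq> i'"
    let ?c = "\<lambda>n. if n = i then 1 else if n = i' then - 1 else (0 :: complex)"
    have "(\<Sum>n\<le>k. smultC (?c n) (g n)) = (\<Sum>n\<in>{i, i'}. smultC (?c n) (g n))"
      by (rule sum.mono_neutral_right) (use i in auto)
    also have "\<dots> = 0" using i by simp
    finally have "?c i = 0" using i by (intro lin) auto
    then show False by simp
  qed
  have "forms.independent (g ` {..k})"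
  proof
    assume "forms.dependent (g ` {..k})"
    then obtain u i where u: "i \<le> k" "u (g i) \<noteq> 0" "(\<Sum>v\<in>g ` {..k}. smultC (u v) v) = 0"
      by (subst (asm) forms.dependent_finite) auto
    from u(3) have "(\<Sum>i\<le>k. smultC (u (g i)) (g i)) = 0"
      by (simp add: sum.reindex [OF inj])
    from lin [OF this u(1)] u(2) show False by simp
  qed
  then have "card (g ` {..k}) \<le> forms.dim ?V"
  proof (rule forms.card_le_dim)
    show "?V \<subseteq> forms.span (monomials j)"
      using homogeneous_in_span_monomials by (auto simp: forms_through_mult_def forms_through_def)
  qed (use gV finite_monomials in auto)
  moreover have "card (g ` {..k}) = j - m - 1"
    using j by (simp add: card_image [OF inj]) (simp add: k_def)
  ultimately show ?thesis by (simp add: dimC_def)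
qed

lemma admits_unexpected_curves_fA2:
  assumes m: "m \<ge> 3" and j: "m + 2 \<le> j" "j \<le> 2 * m - 1"
  shows "admits_unexpected_curves (dual_points (arrangement (fA2 m))) j"
  unfolding admits_unexpected_curves_def
proof (intro conjI)
  have m0: "m > 0" using m by simp
  show "finite (dual_points (arrangement (fA2 m)))"
    using finite_Zpts [OF m0] by (simp add: dual_points_fA2_eq [OF m0])
  show "2 \<le> j" using j by simp
  let ?Z = "dual_points (arrangement (fA2 m))"
  have "(j + 2) choose 2 = (j choose 2) + 2 * j + 1"
    by (simp add: numeral_2_eq_2)
  then have "int (dimC (forms_through j ?Z)) - int (j choose 2) \<le> 2 * int j - 3 * int m - 1"
    using dim_forms_through_le [OF m0, of j] j by simp
  with j have bound: "max 0 (int (dimC (forms_through j ?Z)) - int (j choose 2)) < int (j - m - 1)"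
    by auto
  show "generic (\<lambda>q. max 0 (int (dimC (forms_through j ?Z)) - int (j choose 2))
      < int (dimC (forms_through_mult j ?Z (j - 1) q)))"
    by (rule generic_mono [OF generic_good [OF m0]])
      (use bound dim_forms_through_mult_ge [OF m0 _ j(1)] in force)
qed

text \<open>This makes m + 2 the minimal degree. A point q with positive dimension of curves can be
  chosen good as well, and for a good point no nonzero form of smaller degree exists.\<close>

lemma admits_unexpected_curves_degree:
  assumes m: "m \<ge> 3" and adm: "admits_unexpected_curves (dual_points (arrangement (fA2 m))) j"
  shows "m + 2 \<le> j"
proof (rule ccontr)
  let ?Z = "dual_points (arrangement (fA2 m))"
  assume "\<not> m + 2 \<le> j"
  moreover have j: "2 \<le> j" using adm by (simp add: admits_unexpected_curves_def)
  ultimately have j': "j \<le> m + 1" by simp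
  have "generic (\<lambda>q. int (dimC (forms_through_mult j ?Z (j - 1) q))
       > max 0 (int (dimC (forms_through j ?Z)) - int (j choose 2)))"
    using adm by (simp add: admits_unexpected_curves_def)
  moreover have "generic (\<lambda>q. \<exists>a b. q = pt a b 1 \<and> good m a b)"
    using m by (intro generic_good) simp
  ultimately have "\<exists>q. int (dimC (forms_through_mult j ?Z (j - 1) q)) > max 0 (int (dimC (forms_through j ?Z)) - int (j choose 2)) \<and>
      (\<exists>a b. q = pt a b 1 \<and> good m a b)"
    by (rule generic_both_ex)
  then obtain q a b where q: "int (dimC (forms_through_mult j ?Z (j - 1) q)) > max 0 (int (dimC (forms_through j ?Z)) - int (j choose 2))"
    and "q = pt a b 1" "good m a b" by blast
  then have "dimC (forms_through_mult j ?Z (j - 1) q) = 0"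
    unfolding dimC_def using forms_through_mult_low_degree [OF m \<open>good m a b\<close> j j'] \<open>q = pt a b 1\<close>
    by (simp add: forms.dim_subset_0)
  with q show False by simp
qed

lemma generic_irreducible_unexpected_curves:
  assumes m: "m \<ge> 3"
  shows "generic (\<lambda>q. \<forall>F. unexpected_curve (dual_points (arrangement (fA2 m))) (m + 2) q F \<longrightarrow> irreducible F)"
proof (rule generic_mono [OF generic_good])
  show "m > 0" using m by simp
  fix q assume "\<exists>a b. q = pt a b 1 \<and> good m a b"
  then show "\<forall>F. unexpected_curve (dual_points (arrangement (fA2 m))) (m + 2) q F \<longrightarrow> irreducible F"
    using irreducible_of_minimal_degree [OF m] by (auto simp: unexpected_curve_def)
qed

theorem proposition5p2:
  fixes m :: nat
  assumes "1 \<le> m"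
  shows
    "supersolvable (arrangement (fA2 m)) \<and>
     modular_point (arrangement (fA2 m)) (pt 0 0 1) \<and>
     (2 \<le> m \<longrightarrow> (\<forall>p. modular_point (arrangement (fA2 m)) p \<longrightarrow> p = pt 0 0 1)) \<and>
     free_with_exponents (fA2 m) (m + 1) (2 * m) \<and>
     (3 \<le> m \<longrightarrow>
        (\<forall>j. m + 2 \<le> j \<and> j \<le> 2 * m - 1 \<longrightarrow>
           admits_unexpected_curves (dual_points (arrangement (fA2 m))) j) \<and>
        (\<forall>j. admits_unexpected_curves (dual_points (arrangement (fA2 m))) j \<longrightarrow> m + 2 \<le> j) \<and>
        generic (\<lambda>q. \<forall>F.
           unexpected_curve (dual_points (arrangement (fA2 m))) (m + 2) q F \<longrightarrow> irreducible F))"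
proof -
  have m: "m > 0" using assms by simp
  have mod: "modular_point (arrangement (fA2 m)) (pt 0 0 1)" by (rule modular_fA2 [OF m])
  then have "supersolvable (arrangement (fA2 m))" unfolding supersolvable_def ..
  with mod show ?thesis
    using modular_fA2_unique free_fA2 [OF m] admits_unexpected_curves_fA2
      admits_unexpected_curves_degree generic_irreducible_unexpected_curves by blast
qed

end
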